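(* Let $1\le p\le2$, let $a_1\ge a_2\ge\dots>0$ with $a_t\to0$, and $\Gamma=\{\boldsymbol\theta\in\mathbb{R}^\infty:\sum_{t\ge1}|\theta_t|^p/a_t^p\le1\}$. Let $\epsilon>0$, $\delta=1/32$, $D=D_{\mathsf c}(\Gamma,\epsilon/3)=\min\{D'\ge1: a_{D'}\le\epsilon/3\}$, and $$d_u(\Gamma,n,\epsilon)=\max\Big\{d: a_d^p\,n^{\frac{p-2}{2}}\ge\frac{\epsilon^2/9}{576\log(4D/\delta)}\Big\}.$$ Let $\psi$ be the following test, which uses only the first $D$ coordinates of the LFHT data $\mathbf X=(\mathbf X_1,\dots,\mathbf X_n)$, $\mathbf Y=(\mathbf Y_1,\dots,\mathbf Y_n)$, $\mathbf Z=(\mathbf Z_1,\dots,\mathbf Z_m)$: with $n_0=\lfloor n/2\rfloor$, let $\hat\theta^1_{\mathtt X},\hat\theta^1_{\mathtt Y}$ be the means of the first $n_0$ samples of $\mathbf X,\mathbf Y$, $\hat\theta^2_{\mathtt X},\hat\theta^2_{\mathtt Y}$ the means of the remaining samples, $\hat\theta_{\mathtt Z}$ the mean of $\mathbf Z$; $d_u=d_u(\Gamma,n,\epsilon)$, $T_1=\{1,\dots,d_u\}$, $T_3=\{t\in\{d_u+1,\dots,D\}: |(\hat\theta^1_{\mathtt X})_t-(\hat\theta^1_{\mathtt Y})_t|\ge4\sqrt{2\log(2D/\delta)/n}\}$, $T=T_1\cup T_3$, $T_{\mathtt{LF}}=\sum_{t\in T}[((\hat\theta^2_{\mathtt X})_t-(\hat\theta_{\mathtt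 Z})_t)^2-((\hat\theta^2_{\mathtt Y})_t-(\hat\theta_{\mathtt Z})_t)^2]$, $\psi=\mathbb I\{T_{\mathtt{LF}}\ge0\}$. If $$m\ge\frac{32}{\epsilon^2},\qquad n\ge\frac{32\sqrt{d_u(\Gamma,n,\epsilon)}}{\epsilon^2},\qquad mn\ge\frac{512\,d_u(\Gamma,n,\epsilon)}{\epsilon^4},$$ then $\psi$ satisfies $\max_{i\in\{0,1\}}\sup_{H_i}\mathbb P(\psi\ne i)\le1/4$ in the LFHT problem for $\Gamma$ at scale $\epsilon$.
   Context: LFHT: unknown $\boldsymbol\theta^1,\boldsymbol\theta^2,\boldsymbol\theta\in\Gamma$ with $\|\boldsymbol\theta^1-\boldsymbol\theta^2\|_2\ge\epsilon$; independent data $\mathbf X$: $n$ i.i.d. samples of $\mathcal N(\boldsymbol\theta^1,I_\infty)$, $\mathbf Y$: $n$ i.i.d. samples of $\mathcal N(\boldsymbol\theta^2,I_\infty)$, $\mathbf Z$: $m$ i.i.d. samples of $\mathcal N(\boldsymbol\theta,I_\infty)$ (independent unit-variance Gaussian coordinates); $H_0:\boldsymbol\theta=\boldsymbol\theta^1$ vs $H_1:\boldsymbol\theta=\boldsymbol\theta^2$; $\psi=1$ rejects $H_0$; $\sup_{H_i}$ ranges over admissible parameters with $\boldsymbol\theta=\boldsymbol\theta^{i+1}$. $D_{\mathsf c}$ is the coordinate-wise Kolmogorov dimension, which for this $\Gamma$ the paper identifies with $\min\{D'\ge1:a_{D'}\le\cdot\}$.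
   Formalization: T_1={1,…,d_u} is taken literally, so when d_u>D the test also uses coordinates beyond the first D (the two descriptions then conflict); n≥2 is assumed, since for n≤1 the first-half means are undefined; d_u=0 if no d qualifies. *)

theory Defs
  imports "HOL-Probability.Probability"
begin

text \<open>Coordinates and sample indices are 1-based, as in the paper. A parameter
  theta :: nat => real is only ever used at coordinates t >= 1.\<close>

definition Gamma_set :: "(nat \<Rightarrow> real) \<Rightarrow> real \<Rightarrow> (nat \<Rightarrow> real) set" where
  "Gamma_set a p = {\<theta>. summable (\<lambda>t. \<bar>\<theta> (Suc t)\<bar> powr p / a (Suc t) powr p)
      \<and> (\<Sum>t. \<bar>\<theta> (Suc t)\<bar> powr p / a (Suc t) powr p) \<le> 1}"

definition l2dist :: "(nat \<Rightarrow> real) \<Rightarrow> (nat \<Rightarrow> real) \<Rightarrow> real" where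
  "l2dist \<theta>1 \<theta>2 = sqrt (\<Sum>t. (\<theta>1 (Suc t) - \<theta>2 (Suc t))\<^sup>2)"

definition gauss_seq :: "(nat \<Rightarrow> real) \<Rightarrow> (nat \<Rightarrow> real) measure" where
  "gauss_seq \<theta> = PiM {1..} (\<lambda>t. density lborel (normal_density (\<theta> t) 1))"

definition lfht_measure :: "nat \<Rightarrow> nat \<Rightarrow> (nat \<Rightarrow> real) \<Rightarrow> (nat \<Rightarrow> real) \<Rightarrow> (nat \<Rightarrow> real)
    \<Rightarrow> (((nat \<Rightarrow> nat \<Rightarrow> real) \<times> (nat \<Rightarrow> nat \<Rightarrow> real)) \<times> (nat \<Rightarrow> nat \<Rightarrow> real)) measure" where
  "lfht_measure n m \<theta>1 \<theta>2 \<theta> =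
     (PiM {1..n} (\<lambda>_. gauss_seq \<theta>1) \<Otimes>\<^sub>M PiM {1..n} (\<lambda>_. gauss_seq \<theta>2))
       \<Otimes>\<^sub>M PiM {1..m} (\<lambda>_. gauss_seq \<theta>)"

definition Dc :: "(nat \<Rightarrow> real) \<Rightarrow> real \<Rightarrow> nat" where
  "Dc a \<epsilon> = (LEAST D'. D' \<ge> 1 \<and> a D' \<le> \<epsilon> / 3)"

definition delta :: real where "delta = 1/32"

text \<open>d_u(Gamma,n,eps); the maximum of an empty set is taken to be 0.\<close>
definition d_u :: "(nat \<Rightarrow> real) \<Rightarrow> real \<Rightarrow> nat \<Rightarrow> real \<Rightarrow> nat" where
  "d_u a p n \<epsilon> = Max ({0} \<union> {d. d \<ge> 1 \<and>
      a d powr p * real n powr ((p - 2) / 2)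
        \<ge> (\<epsilon>\<^sup>2 / 9) / (576 * ln (4 * real (Dc a \<epsilon>) / delta))})"

definition smean :: "(nat \<Rightarrow> nat \<Rightarrow> real) \<Rightarrow> nat set \<Rightarrow> nat \<Rightarrow> real" where
  "smean X I t = (\<Sum>i\<in>I. X i t) / real (card I)"

text \<open>The test psi; True means psi = 1 (reject H0).\<close>
definition lfht_test :: "(nat \<Rightarrow> real) \<Rightarrow> real \<Rightarrow> real \<Rightarrow> nat \<Rightarrow> nat
    \<Rightarrow> (nat \<Rightarrow> nat \<Rightarrow> real) \<Rightarrow> (nat \<Rightarrow> nat \<Rightarrow> real) \<Rightarrow> (nat \<Rightarrow> nat \<Rightarrow> real) \<Rightarrow> bool" where
  "lfht_test a p \<epsilon> n m X Y Z =
    (let D = Dc a \<epsilon>; du = d_u a p n \<epsilon>; n0 = n div 2;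
         h1X = smean X {1..n0}; h1Y = smean Y {1..n0};
         h2X = smean X {n0+1..n}; h2Y = smean Y {n0+1..n};
         hZ = smean Z {1..m};
         T3 = {t \<in> {du+1..D}. \<bar>h1X t - h1Y t\<bar> \<ge> 4 * sqrt (2 * ln (2 * real D / delta) / real n)};
         T = {1..du} \<union> T3;
         TLF = (\<Sum>t\<in>T. (h2X t - hZ t)\<^sup>2 - (h2Y t - hZ t)\<^sup>2)
     in TLF \<ge> 0)"

end

theory Submission
  imports Defs
begin

text \<open>
  Write $\Delta = \theta^1 - \theta^2$. Given the first halves of the samples, the selected set $T$
  is fixed and the statistic is a sum over $t \in T$ of independent quadratic forms in three
  Gaussians, whose exponential moments are explicit. Chebyshev's inequality is too weak for the
  stated constants, so the error is bounded by a Chernoff bound with tilt $c/\epsilon^2$.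

  With $q_t = |\Delta_t| / (2 a_t)$, convexity gives $\sum_t q_t^p \le 1$. Let
  $K = \epsilon^2 / (5184 \log(4D/\delta))$, so that $a_t^p < K n^{(2-p)/2}$ beyond $d_u$. Outside an
  event of probability at most $1/256$, every screened coordinate has
  $|\Delta_t| \ge \tau/4$ and every discarded one $|\Delta_t| \le 7\tau/4$, where $\tau$ is the screening
  threshold. Hence at most $Kn$ coordinates are screened in.
  If $Kn \le 1$, no coordinate is screened in and the signal beyond $d_u$ is at most $4K$, so
  almost all of $\|\Delta\|^2$ is captured and $c = 3$ works. If $Kn > 1$, up to $4\epsilon^2/9$
  of the signal may be lost beyond $D$, but then $n\epsilon^2 > 20736$ makes the noise of
  $X$ and $Y$ negligible and $c = 11/2$ works. In both cases the Chernoff exponent is at most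
  $-1.41$, and $e^{-1.41} + 1/256 \le 1/4$.
\<close>

section \<open>Gaussian exponential moments\<close>

text \<open>The selected set is random. Instead of conditioning on it, the proof lists its finitely
  many possible values \<open>B\<close>: the event that screening returns \<open>B\<close> involves
  only the first halves, and the error with \<open>B\<close> held fixed involves only the other
  means, so a bound uniform in \<open>B\<close> survives the summation. Two tilts are needed because
  neither covers both regimes. Divide all variances by \<epsilon>^2, so that those of the
  second-half means and of the mean of Z are only known to be at most 1/16 and 1/32. With few
  samples both values may occur, and for c = 11/2 the quadratic loss (121/2)(1/16 + 1/32) exceeds
  the linear gain 11/2. With many samples the captured signal may be as small as 0.537 \<epsilon>^2,
  and for c = 3 the gain is then only 0.537 (3 - 18/32) < 1.31, too little even before the noise
  term is added. The two error types are one statement: exchanging the second halves of X and Y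
  changes the sign of the statistic.\<close>

lemma nn_integral_exp_quadratic_normal:
  fixes b c \<mu> v :: real
  assumes v: "v > 0" and bv: "2 * b * v < 1"
  shows "(\<integral>\<^sup>+x. ennreal (exp (b * x\<^sup>2 + c * x)) \<partial>density lborel (normal_density \<mu> (sqrt v)))
    = ennreal (exp ((\<mu>\<^sup>2 * b + c * \<mu> + c\<^sup>2 * v / 2) / (1 - 2 * b * v)) / sqrt (1 - 2 * b * v))"
proof -
  define k where "k = 1 - 2 * b * v"
  have k: "k > 0" using bv by (simp add: k_def)
  have b: "b = (1 - k) / (2 * v)" using v by (simp add: k_def)
  define C where "C = exp ((\<mu>\<^sup>2 * b + c * \<mu> + c\<^sup>2 * v / 2) / k) / sqrt k"
  have C: "C \<ge> 0" using k by (simp add: C_def)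
  \<comment> \<open>Completing the square: the tilted density is \<open>C\<close> times the normal
    density with mean (\<mu> + c v)/k and variance v/k, so the integral is \<open>C\<close>.\<close>
  have exponent: "b * x\<^sup>2 + c * x - (x - \<mu>)\<^sup>2 / (2 * v)
      = (\<mu>\<^sup>2 * b + c * \<mu> + c\<^sup>2 * v / 2) / k - (x - (\<mu> + c * v) / k)\<^sup>2 / (2 * (v / k))" for x
    unfolding b using v k by (simp add: divide_simps power2_eq_square) algebra
  have eq: "normal_density \<mu> (sqrt v) x * exp (b * x\<^sup>2 + c * x)
      = C * normal_density ((\<mu> + c * v) / k) (sqrt (v / k)) x" for x
  proof -
    have "normal_density \<mu> (sqrt v) x * exp (b * x\<^sup>2 + c * x)
        = exp (b * x\<^sup>2 + c * x - (x - \<mu>)\<^sup>2 / (2 * v)) / sqrt (2 * pi * v)"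
      using v by (simp add: normal_density_def diff_divide_distrib minus_divide_left[symmetric] mult.commute flip: exp_add)
    also have "\<dots> = exp ((\<mu>\<^sup>2 * b + c * \<mu> + c\<^sup>2 * v / 2) / k)
        * exp (- (x - (\<mu> + c * v) / k)\<^sup>2 / (2 * (v / k))) / sqrt (2 * pi * v)"
      unfolding exponent by (simp add: exp_diff exp_minus field_simps)
    also have "sqrt (2 * pi * v) = sqrt k * sqrt (2 * pi * (v / k))"
      using k by (simp add: real_sqrt_mult[symmetric])
    finally show ?thesis
      using v k by (simp add: C_def normal_density_def)
  qed
  interpret N: prob_space "density lborel (normal_density ((\<mu> + c * v) / k) (sqrt (v / k)))"
    using v k by (intro prob_space_normal_density) simp
  have one: "(\<integral>\<^sup>+x. ennreal (normal_density ((\<mu> + c * v) / k) (sqrt (v / k)) x) \<partial>lborel) = 1"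
    using N.emeasure_space_1 by (simp add: emeasure_density)
  have "(\<integral>\<^sup>+x. ennreal (exp (b * x\<^sup>2 + c * x)) \<partial>density lborel (normal_density \<mu> (sqrt v)))
    = (\<integral>\<^sup>+x. ennreal C * ennreal (normal_density ((\<mu> + c * v) / k) (sqrt (v / k)) x) \<partial>lborel)"
    using C by (subst nn_integral_density)
      (auto intro!: nn_integral_cong simp: ennreal_mult[symmetric] eq)
  also have "\<dots> = ennreal C"
    by (subst nn_integral_cmult) (auto simp: one)
  finally show ?thesis by (simp add: C_def k_def)
qed

lemma nn_integral_exp_normal:
  fixes c \<mu> v :: real
  assumes "v > 0"
  shows "(\<integral>\<^sup>+x. ennreal (exp (c * x)) \<partial>density lborel (normal_density \<mu> (sqrt v)))
    = ennreal (exp (c * \<mu> + c\<^sup>2 * v / 2))"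
  using nn_integral_exp_quadratic_normal[where b = 0] assms by simp

text \<open>Take the square root in 1/(1-x) = 1 + x/(1-x) \<le> exp(x/(1-x)). In this form the
  determinant factor of a Gaussian moment gets the denominator 1-x that its exponent already has, so
  both merge into one fraction.\<close>

lemma inverse_sqrt_one_minus_le_exp:
  fixes x :: real
  assumes "0 \<le> x" "x < 1"
  shows "1 / sqrt (1 - x) \<le> exp (x / 2 / (1 - x))"
proof -
  have "1 / (1 - x) = 1 + x / (1 - x)"
    using assms by (simp add: field_simps)
  also have "\<dots> \<le> exp (x / (1 - x))"
    by (rule exp_ge_add_one_self)
  also have "\<dots> = (exp (x / 2 / (1 - x)))\<^sup>2"
    using assms by (subst exp_double[symmetric]) (simp add: field_simps)
  finally have "sqrt (1 / (1 - x)) \<le> exp (x / 2 / (1 - x))"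
    by (intro real_le_lsqrt) auto
  then show ?thesis by (simp add: real_sqrt_divide)
qed

text \<open>The squares of z cancel, so the innermost integral is linear in z; the other two are
  Gaussian moments of quadratics. The origin is placed at the common mean of the first and third
  variable, which leaves a mean only in y. The hypothesis \<open>small\<close> is finiteness of the
  middle integral.\<close>

lemma nn_integral_exp_distance_difference_le:
  fixes l v w s :: real
  assumes v: "v > 0" and w: "w > 0" and l: "l > 0" and small: "2 * l * v + 4 * l\<^sup>2 * w * v < 1"
    and x: "x = 4 * l\<^sup>2 * v * (v + 2 * w)" and x1: "x < 1"
  shows "(\<integral>\<^sup>+y. (\<integral>\<^sup>+x. (\<integral>\<^sup>+z. ennreal (exp (l * ((x - z)\<^sup>2 - (y - z)\<^sup>2)))
            \<partial>density lborel (normal_density 0 (sqrt w)))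
          \<partial>density lborel (normal_density 0 (sqrt v)))
        \<partial>density lborel (normal_density s (sqrt v)))
     \<le> ennreal (exp ((x / 2 - s\<^sup>2 * (l - 2 * l\<^sup>2 * (v + w))) / (1 - x)))"
proof -
  define A where "A = l + 2 * l\<^sup>2 * w"
  define k where "k = 1 - 2 * A * v"
  define B where "B = - l + 2 * l\<^sup>2 * w + 8 * l^4 * w\<^sup>2 * v / k"
  have k: "k > 0" using small by (simp add: k_def A_def algebra_simps)
  \<comment> \<open>The two remaining integrals contribute 1/sqrt of \<open>k\<close> and of
    \<open>1 - 2 * B * v\<close>. Their product is the determinant 1-x, whose positivity also gives
    finiteness of the outer integral.\<close>
  have kB: "k * (1 - 2 * B * v) = 1 - x"
    using k unfolding B_def by (simp add: field_simps) (simp add: k_def A_def x; algebra)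
  have Bk: "B * k = - (l - 2 * l\<^sup>2 * (v + w))"
    using k unfolding B_def by (simp add: field_simps) (simp add: k_def A_def; algebra)
  have k2: "1 - 2 * B * v > 0" using kB k x1 by (metis diff_gt_0_iff_gt zero_less_mult_pos)
  have x0: "x \<ge> 0" unfolding x using v w l by simp
  have z_int: "(\<integral>\<^sup>+z. ennreal (exp (l * ((x - z)\<^sup>2 - (y - z)\<^sup>2))) \<partial>density lborel (normal_density 0 (sqrt w)))
      = ennreal (exp ((- l + 2 * l\<^sup>2 * w) * y\<^sup>2)) * ennreal (exp (A * x\<^sup>2 + (- 4 * l\<^sup>2 * w * y) * x))" for x y
  proof -
    have "(\<integral>\<^sup>+z. ennreal (exp (l * ((x - z)\<^sup>2 - (y - z)\<^sup>2))) \<partial>density lborel (normal_density 0 (sqrt w)))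
      = (\<integral>\<^sup>+z. ennreal (exp (l * (x\<^sup>2 - y\<^sup>2))) * ennreal (exp ((- 2 * l * (x - y)) * z))
          \<partial>density lborel (normal_density 0 (sqrt w)))"
      by (intro nn_integral_cong)
        (simp add: ennreal_mult[symmetric] exp_add[symmetric] power2_eq_square algebra_simps)
    also have "\<dots> = ennreal (exp (l * (x\<^sup>2 - y\<^sup>2))) * ennreal (exp ((- 2 * l * (x - y))\<^sup>2 * w / 2))"
      using w by (subst nn_integral_cmult, measurable) (subst nn_integral_exp_normal, simp_all)
    also have "\<dots> = ennreal (exp ((- l + 2 * l\<^sup>2 * w) * y\<^sup>2)) * ennreal (exp (A * x\<^sup>2 + (- 4 * l\<^sup>2 * w * y) * x))"
      unfolding A_def
      by (simp add: ennreal_mult[symmetric] exp_add[symmetric] power2_eq_square field_simps)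
    finally show ?thesis .
  qed
  have x_int: "(\<integral>\<^sup>+x. (\<integral>\<^sup>+z. ennreal (exp (l * ((x - z)\<^sup>2 - (y - z)\<^sup>2)))
            \<partial>density lborel (normal_density 0 (sqrt w))) \<partial>density lborel (normal_density 0 (sqrt v)))
      = ennreal (1 / sqrt k) * ennreal (exp (B * y\<^sup>2 + 0 * y))" for y
  proof -
    have "(\<integral>\<^sup>+x. (\<integral>\<^sup>+z. ennreal (exp (l * ((x - z)\<^sup>2 - (y - z)\<^sup>2)))
            \<partial>density lborel (normal_density 0 (sqrt w))) \<partial>density lborel (normal_density 0 (sqrt v)))
      = ennreal (exp ((- l + 2 * l\<^sup>2 * w) * y\<^sup>2)) *
        ennreal (exp (((- 4 * l\<^sup>2 * w * y)\<^sup>2 * v / 2) / k) / sqrt k)"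
      unfolding z_int using v k
      by (subst nn_integral_cmult, measurable)
        (subst nn_integral_exp_quadratic_normal, simp_all add: k_def)
    also have "\<dots> = ennreal (1 / sqrt k * exp ((- l + 2 * l\<^sup>2 * w) * y\<^sup>2 + ((- 4 * l\<^sup>2 * w * y)\<^sup>2 * v / 2) / k))"
      using k by (simp add: ennreal_mult[symmetric] exp_add)
    also have "(- l + 2 * l\<^sup>2 * w) * y\<^sup>2 + ((- 4 * l\<^sup>2 * w * y)\<^sup>2 * v / 2) / k = B * y\<^sup>2 + 0 * y"
      unfolding B_def using k by (simp add: field_simps power2_eq_square power4_eq_xxxx)
    finally show ?thesis using k by (simp add: ennreal_mult[symmetric])
  qed
  have "(\<integral>\<^sup>+y. (\<integral>\<^sup>+x. (\<integral>\<^sup>+z. ennreal (exp (l * ((x - z)\<^sup>2 - (y - z)\<^sup>2)))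
            \<partial>density lborel (normal_density 0 (sqrt w)))
          \<partial>density lborel (normal_density 0 (sqrt v)))
        \<partial>density lborel (normal_density s (sqrt v)))
     = ennreal (1 / sqrt k) * ennreal (exp (s\<^sup>2 * B / (1 - 2 * B * v)) / sqrt (1 - 2 * B * v))"
    unfolding x_int using v k2
    by (subst nn_integral_cmult, measurable) (subst nn_integral_exp_quadratic_normal, simp_all)
  also have "\<dots> = ennreal (exp (s\<^sup>2 * (B * k) / (k * (1 - 2 * B * v))) / sqrt (k * (1 - 2 * B * v)))"
    using k k2 by (simp add: ennreal_mult[symmetric] real_sqrt_mult mult.commute)
  also have "\<dots> = ennreal (exp (s\<^sup>2 * - (l - 2 * l\<^sup>2 * (v + w)) / (1 - x)) * (1 / sqrt (1 - x)))"
    unfolding kB Bk by simp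
  also have "\<dots> \<le> ennreal (exp (s\<^sup>2 * - (l - 2 * l\<^sup>2 * (v + w)) / (1 - x)) * exp (x / 2 / (1 - x)))"
    by (intro ennreal_leI mult_left_mono inverse_sqrt_one_minus_le_exp x0 x1) auto
  also have "\<dots> = ennreal (exp ((x / 2 - s\<^sup>2 * (l - 2 * l\<^sup>2 * (v + w))) / (1 - x)))"
    by (simp only: exp_add[symmetric] mult_minus_right diff_divide_distrib minus_divide_left[symmetric] uminus_add_conv_diff)
  finally show ?thesis .
qed

section \<open>Tail bounds for normal variables and for sums of contrasts\<close>

lemma (in prob_space) nn_integral_normal_distributed:
  fixes X :: "'a \<Rightarrow> real" and f :: "real \<Rightarrow> ennreal"
  assumes X: "distributed M lborel X (normal_density \<mu> \<sigma>)" and [measurable]: "f \<in> borel_measurable borel"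
  shows "(\<integral>\<^sup>+\<omega>. f (X \<omega>) \<partial>M) = (\<integral>\<^sup>+x. f x \<partial>density lborel (normal_density \<mu> \<sigma>))"
proof -
  have [measurable]: "X \<in> borel_measurable M" using distributed_measurable[OF X] by simp
  show ?thesis
    unfolding distributed_distr_eq_density[OF X, symmetric] by (subst nn_integral_distr) auto
qed

lemma (in prob_space) distr_borel_normal:
  assumes "distributed M lborel X (normal_density \<mu> \<sigma>)"
  shows "distr M borel X = density lborel (normal_density \<mu> \<sigma>)"
  unfolding distributed_distr_eq_density[OF assms, symmetric] by (rule distr_cong) auto

lemma (in prob_space) chernoff_bound:
  fixes X :: "'a \<Rightarrow> real"
  assumes [measurable]: "random_variable borel X"
    and B: "(\<integral>\<^sup>+\<omega>. ennreal (exp (X \<omega>)) \<partial>M) \<le> ennreal B" "B \<ge> 0"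
  shows "prob {\<omega> \<in> space M. X \<omega> \<ge> 0} \<le> B"
proof -
  have "emeasure M {\<omega> \<in> space M. X \<omega> \<ge> 0} = (\<integral>\<^sup>+\<omega>. indicator {\<omega> \<in> space M. X \<omega> \<ge> 0} \<omega> \<partial>M)"
    by simp
  also have "\<dots> \<le> (\<integral>\<^sup>+\<omega>. ennreal (exp (X \<omega>)) \<partial>M)"
    by (intro nn_integral_mono) (auto split: split_indicator simp: ennreal_1[symmetric] simp del: ennreal_1)
  finally have "emeasure M {\<omega> \<in> space M. X \<omega> \<ge> 0} \<le> ennreal B"
    using B(1) by (rule order_trans)
  then show ?thesis using B(2) by (simp add: emeasure_eq_measure)
qed

lemma (in prob_space) normal_deviation_bound:
  fixes X :: "'a \<Rightarrow> real"
  assumes X: "distributed M lborel X (normal_density \<mu> (sqrt v))" and v: "v > 0" and s: "s \<ge> 0"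
  shows "prob {\<omega> \<in> space M. \<bar>X \<omega> - \<mu>\<bar> \<ge> s} \<le> 2 * exp (- s\<^sup>2 / (2 * v))"
proof -
  have [measurable]: "X \<in> borel_measurable M" using distributed_measurable[OF X] by simp
  \<comment> \<open>Only c^2 enters the bound, so one computation serves both tails, c = s/v and c =
    -s/v; this is the optimal tilt.\<close>
  have one_sided: "prob {\<omega> \<in> space M. c * (X \<omega> - \<mu>) - s\<^sup>2 / v \<ge> 0} \<le> exp (- s\<^sup>2 / (2 * v))"
    if c: "c\<^sup>2 = (s / v)\<^sup>2" for c
  proof (rule chernoff_bound)
    have "(\<integral>\<^sup>+\<omega>. ennreal (exp (c * (X \<omega> - \<mu>) - s\<^sup>2 / v)) \<partial>M)
        = (\<integral>\<^sup>+\<omega>. ennreal (exp (- c * \<mu> - s\<^sup>2 / v)) * ennreal (exp (c * X \<omega>)) \<partial>M)"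
      by (intro nn_integral_cong) (simp add: ennreal_mult[symmetric] exp_add[symmetric] algebra_simps)
    also have "\<dots> = ennreal (exp (- c * \<mu> - s\<^sup>2 / v)) * ennreal (exp (c * \<mu> + c\<^sup>2 * v / 2))"
      using v by (subst nn_integral_cmult, measurable)
        (subst nn_integral_normal_distributed[OF X], simp_all add: nn_integral_exp_normal)
    also have "\<dots> = ennreal (exp (- s\<^sup>2 / (2 * v)))"
      unfolding c using v
      by (simp add: ennreal_mult[symmetric] exp_add[symmetric] field_simps power2_eq_square)
    finally show "(\<integral>\<^sup>+\<omega>. ennreal (exp (c * (X \<omega> - \<mu>) - s\<^sup>2 / v)) \<partial>M) \<le> ennreal (exp (- s\<^sup>2 / (2 * v)))"
      by simp
  qed auto
  have tail: "c * y - s\<^sup>2 / v \<ge> 0" if "c = s / v" "y \<ge> s" for c y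
    using that v s by (simp add: power2_eq_square divide_right_mono mult_left_mono)
  have "prob {\<omega> \<in> space M. \<bar>X \<omega> - \<mu>\<bar> \<ge> s}
      \<le> prob ({\<omega> \<in> space M. s / v * (X \<omega> - \<mu>) - s\<^sup>2 / v \<ge> 0}
             \<union> {\<omega> \<in> space M. - (s / v) * (X \<omega> - \<mu>) - s\<^sup>2 / v \<ge> 0})"
  proof (rule finite_measure_mono)
    show "{\<omega> \<in> space M. \<bar>X \<omega> - \<mu>\<bar> \<ge> s} \<subseteq> {\<omega> \<in> space M. s / v * (X \<omega> - \<mu>) - s\<^sup>2 / v \<ge> 0}
             \<union> {\<omega> \<in> space M. - (s / v) * (X \<omega> - \<mu>) - s\<^sup>2 / v \<ge> 0}"
    proof
      fix \<omega> assume w: "\<omega> \<in> {\<omega> \<in> space M. \<bar>X \<omega> - \<mu>\<bar> \<ge> s}"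
      then consider "X \<omega> - \<mu> \<ge> s" | "- (X \<omega> - \<mu>) \<ge> s" by fastforce
      then show "\<omega> \<in> {\<omega> \<in> space M. s / v * (X \<omega> - \<mu>) - s\<^sup>2 / v \<ge> 0}
             \<union> {\<omega> \<in> space M. - (s / v) * (X \<omega> - \<mu>) - s\<^sup>2 / v \<ge> 0}"
      proof cases
        case 1 then show ?thesis using w tail[OF refl 1] by simp
      next
        case 2 then show ?thesis using w tail[OF refl 2] by (simp add: algebra_simps)
      qed
    qed
  qed measurable
  also have "\<dots> \<le> exp (- s\<^sup>2 / (2 * v)) + exp (- s\<^sup>2 / (2 * v))"
    by (intro order_trans[OF measure_Un_le] add_mono one_sided) auto
  finally show ?thesis by simp
qed

lemma (in prob_space) nn_integral_exp_contrast_le: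
  fixes G :: "'k \<Rightarrow> 'a \<Rightarrow> real" and v w l x \<theta> \<theta>' :: real
  assumes ind: "indep_vars (\<lambda>_. borel) G {a, b, c}" and neq: "a \<noteq> b" "a \<noteq> c" "b \<noteq> c"
    and Ga: "distributed M lborel (G a) (normal_density \<theta> (sqrt v))"
    and Gb: "distributed M lborel (G b) (normal_density \<theta>' (sqrt v))"
    and Gc: "distributed M lborel (G c) (normal_density \<theta> (sqrt w))"
    and v: "v > 0" and w: "w > 0" and l: "l > 0" and small: "2 * l * v + 4 * l\<^sup>2 * w * v < 1"
    and x: "x = 4 * l\<^sup>2 * v * (v + 2 * w)" and x1: "x < 1"
  shows "(\<integral>\<^sup>+\<omega>. ennreal (exp (l * ((G a \<omega> - G c \<omega>)\<^sup>2 - (G b \<omega> - G c \<omega>)\<^sup>2))) \<partial>M)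
    \<le> ennreal (exp ((x / 2 - (\<theta> - \<theta>')\<^sup>2 * (l - 2 * l\<^sup>2 * (v + w))) / (1 - x)))"
proof -
  \<comment> \<open>A common shift by \<theta> cancels in both differences and centres the variables
    with labels a and c.\<close>
  define X where "X = (\<lambda>\<omega>. - \<theta> + 1 * G a \<omega>)"
  define Y where "Y = (\<lambda>\<omega>. - \<theta> + 1 * G b \<omega>)"
  define Z where "Z = (\<lambda>\<omega>. - \<theta> + 1 * G c \<omega>)"
  have DX: "distributed M lborel X (normal_density 0 (sqrt v))"
    using normal_density_affine[OF Ga, of 1 "- \<theta>"] v unfolding X_def by simp
  have DY: "distributed M lborel Y (normal_density (\<theta>' - \<theta>) (sqrt v))"
    using normal_density_affine[OF Gb, of 1 "- \<theta>"] v unfolding Y_def by simp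
  have DZ: "distributed M lborel Z (normal_density 0 (sqrt w))"
    using normal_density_affine[OF Gc, of 1 "- \<theta>"] w unfolding Z_def by simp
  have XYZ: "X \<in> borel_measurable M" "Y \<in> borel_measurable M" "Z \<in> borel_measurable M"
    using distributed_measurable[OF DX] distributed_measurable[OF DY] distributed_measurable[OF DZ] by auto
  define N where "N k = density lborel (normal_density (if k = b then \<theta>' - \<theta> else 0) (sqrt (if k = c then w else v)))" for k
  interpret N: prob_space "N k" for k
    unfolding N_def using v w by (intro prob_space_normal_density) simp
  interpret P: product_sigma_finite N
    by unfold_locales
  define H where "H k \<omega> = - \<theta> + 1 * G k \<omega>" for k \<omega>
  have "indep_vars (\<lambda>_. borel) H {a, b, c}"
    unfolding H_def by (rule indep_vars_compose2[OF ind]) auto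
  moreover have [measurable]: "H k \<in> borel_measurable M" if "k \<in> {a, b, c}" for k
    using that XYZ by (auto simp: H_def[abs_def] X_def Y_def Z_def)
  ultimately have "distr M (\<Pi>\<^sub>M k\<in>{a, b, c}. borel) (\<lambda>\<omega>. \<lambda>k\<in>{a, b, c}. H k \<omega>)
      = (\<Pi>\<^sub>M k\<in>{a, b, c}. distr M borel (H k))"
    by (subst indep_vars_iff_distr_eq_PiM'[symmetric]) auto
  also have "\<dots> = PiM {a, b, c} N"
    using neq distr_borel_normal[OF DX] distr_borel_normal[OF DY] distr_borel_normal[OF DZ]
    by (intro PiM_cong) (auto simp: N_def H_def[abs_def] X_def Y_def Z_def)
  \<comment> \<open>Inserted in this order, the labels are peeled off as b, a, c, which matches the
    nesting y, x, z of the iterated integral.\<close>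
  also have "{a, b, c} = insert b (insert a {c})" by auto
  finally have D: "distr M (\<Pi>\<^sub>M k\<in>insert b (insert a {c}). borel) (\<lambda>\<omega>. \<lambda>k\<in>insert b (insert a {c}). H k \<omega>)
      = PiM (insert b (insert a {c})) N" .
  have [measurable_cong]: "sets (N k) = sets borel" for k by (simp add: N_def)
  let ?f = "\<lambda>x y z. ennreal (exp (l * ((x - z)\<^sup>2 - (y - z)\<^sup>2)))"
  have "(\<integral>\<^sup>+\<omega>. ennreal (exp (l * ((G a \<omega> - G c \<omega>)\<^sup>2 - (G b \<omega> - G c \<omega>)\<^sup>2))) \<partial>M)
      = (\<integral>\<^sup>+\<omega>. (\<lambda>g. ?f (g a) (g b) (g c)) (\<lambda>k\<in>insert b (insert a {c}). H k \<omega>) \<partial>M)"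
    by (simp add: H_def)
  also have "\<dots> = (\<integral>\<^sup>+g. ?f (g a) (g b) (g c) \<partial>PiM (insert b (insert a {c})) N)"
    unfolding D[symmetric] by (subst nn_integral_distr) (auto intro!: measurable_restrict)
  also have "\<dots> = (\<integral>\<^sup>+y. (\<integral>\<^sup>+g. ?f (g a) y (g c) \<partial>PiM (insert a {c}) N) \<partial>N b)"
    using neq by (subst P.product_nn_integral_insert_rev) auto
  also have "\<dots> = (\<integral>\<^sup>+y. (\<integral>\<^sup>+x. (\<integral>\<^sup>+g. ?f x y (g c) \<partial>PiM {c} N) \<partial>N a) \<partial>N b)"
    using neq by (subst P.product_nn_integral_insert_rev) auto
  also have "\<dots> = (\<integral>\<^sup>+y. (\<integral>\<^sup>+x. (\<integral>\<^sup>+z. ?f x y z \<partial>N c) \<partial>N a) \<partial>N b)"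
    by (subst P.product_nn_integral_singleton) auto
  also have "\<dots> \<le> ennreal (exp ((x / 2 - (\<theta>' - \<theta>)\<^sup>2 * (l - 2 * l\<^sup>2 * (v + w))) / (1 - x)))"
    using nn_integral_exp_distance_difference_le[OF v w l small x x1] neq by (simp add: N_def)
  finally show ?thesis by (simp add: power2_commute)
qed

text \<open>Independence across coordinates multiplies the exponential moments. As all factors share
  the denominator 1-x, the result depends on \<open>T\<close> only through its cardinality and its
  total signal. The means with labels a and c agree, so a nonnegative sum is the unlikely
  outcome.\<close>

lemma (in prob_space) contrast_sum_tail_bound:
  fixes G :: "'k \<times> 't \<Rightarrow> 'a \<Rightarrow> real" and v w l x :: real and \<theta> \<theta>' :: "'t \<Rightarrow> real"
  assumes ind: "indep_vars (\<lambda>_. borel) G ({a, b, c} \<times> T)" and fin: "finite T"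
    and neq: "a \<noteq> b" "a \<noteq> c" "b \<noteq> c"
    and Ga: "\<And>t. t \<in> T \<Longrightarrow> distributed M lborel (G (a, t)) (normal_density (\<theta> t) (sqrt v))"
    and Gb: "\<And>t. t \<in> T \<Longrightarrow> distributed M lborel (G (b, t)) (normal_density (\<theta>' t) (sqrt v))"
    and Gc: "\<And>t. t \<in> T \<Longrightarrow> distributed M lborel (G (c, t)) (normal_density (\<theta> t) (sqrt w))"
    and v: "v > 0" and w: "w > 0" and l: "l > 0" and small: "2 * l * v + 4 * l\<^sup>2 * w * v < 1"
    and x: "x = 4 * l\<^sup>2 * v * (v + 2 * w)" and x1: "x < 1"
  shows "prob {\<omega> \<in> space M. (\<Sum>t\<in>T. (G (a, t) \<omega> - G (c, t) \<omega>)\<^sup>2 - (G (b, t) \<omega> - G (c, t) \<omega>)\<^sup>2) \<ge> 0}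
    \<le> exp ((real (card T) * x / 2 - (\<Sum>t\<in>T. (\<theta> t - \<theta>' t)\<^sup>2) * (l - 2 * l\<^sup>2 * (v + w))) / (1 - x))"
proof -
  let ?f = "\<lambda>t \<omega>. (G (a, t) \<omega> - G (c, t) \<omega>)\<^sup>2 - (G (b, t) \<omega> - G (c, t) \<omega>)\<^sup>2"
  let ?B = "\<lambda>t. exp ((x / 2 - (\<theta> t - \<theta>' t)\<^sup>2 * (l - 2 * l\<^sup>2 * (v + w))) / (1 - x))"
  have [measurable]: "G (k, t) \<in> borel_measurable M" if "k \<in> {a, b, c}" "t \<in> T" for k t
    using ind that by (auto simp: indep_vars_def)
  have meas: "(\<lambda>\<omega>. l * (\<Sum>t\<in>T. ?f t \<omega>)) \<in> borel_measurable M"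
    by measurable
  have "indep_vars (\<lambda>_. borel) (\<lambda>t \<omega>. (\<lambda>g. exp (l * ((g (a, t) - g (c, t))\<^sup>2 - (g (b, t) - g (c, t))\<^sup>2)))
      (restrict (\<lambda>i. G i \<omega>) ({a, b, c} \<times> {t}))) T"
    by (rule indep_vars_compose2[OF indep_vars_restrict[OF ind]])
      (auto simp: disjoint_family_on_def)
  then have indf: "indep_vars (\<lambda>_. borel) (\<lambda>t \<omega>. exp (l * ?f t \<omega>)) T"
    by simp
  have coord: "(\<integral>\<^sup>+\<omega>. ennreal (exp (l * ?f t \<omega>)) \<partial>M) \<le> ennreal (?B t)" if t: "t \<in> T" for t
  proof -
    have "indep_vars (\<lambda>_. borel) (\<lambda>k \<omega>. (\<lambda>g. g (k, t)) (restrict (\<lambda>i. G i \<omega>) {(k, t)})) {a, b, c}"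
      by (rule indep_vars_compose2[OF indep_vars_restrict[OF ind]])
        (use t in \<open>auto simp: disjoint_family_on_def\<close>)
    then have "indep_vars (\<lambda>_. borel) (\<lambda>k \<omega>. G (k, t) \<omega>) {a, b, c}" by simp
    then show ?thesis
      using nn_integral_exp_contrast_le[of "\<lambda>k. G (k, t)" a b c, OF _ neq Ga[OF t] Gb[OF t] Gc[OF t] v w l small x x1]
      by simp
  qed
  have "prob {\<omega> \<in> space M. l * (\<Sum>t\<in>T. ?f t \<omega>) \<ge> 0} \<le> (\<Prod>t\<in>T. ?B t)"
  proof (rule chernoff_bound[OF meas])
    have "(\<integral>\<^sup>+\<omega>. ennreal (exp (l * (\<Sum>t\<in>T. ?f t \<omega>))) \<partial>M) = (\<integral>\<^sup>+\<omega>. (\<Prod>t\<in>T. ennreal (exp (l * ?f t \<omega>))) \<partial>M)"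
      by (simp add: sum_distrib_left exp_sum fin prod_ennreal)
    also have "\<dots> = (\<Prod>t\<in>T. \<integral>\<^sup>+\<omega>. ennreal (exp (l * ?f t \<omega>)) \<partial>M)"
      using indf fin
      by (intro indep_vars_nn_integral) (auto intro!: indep_vars_compose2[where M' = "\<lambda>_. borel" and Y = "\<lambda>_. ennreal"])
    also have "\<dots> \<le> (\<Prod>t\<in>T. ennreal (?B t))"
      by (intro prod_mono_ennreal coord)
    finally show "(\<integral>\<^sup>+\<omega>. ennreal (exp (l * (\<Sum>t\<in>T. ?f t \<omega>))) \<partial>M) \<le> ennreal (\<Prod>t\<in>T. ?B t)"
      by (simp add: prod_ennreal)
  qed (auto intro: prod_nonneg)
  also have "(\<Prod>t\<in>T. ?B t) = exp (\<Sum>t\<in>T. (x / 2 - (\<theta> t - \<theta>' t)\<^sup>2 * (l - 2 * l\<^sup>2 * (v + w))) / (1 - x))"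
    by (simp add: exp_sum fin)
  also have "(\<Sum>t\<in>T. (x / 2 - (\<theta> t - \<theta>' t)\<^sup>2 * (l - 2 * l\<^sup>2 * (v + w))) / (1 - x))
      = (real (card T) * x / 2 - (\<Sum>t\<in>T. (\<theta> t - \<theta>' t)\<^sup>2) * (l - 2 * l\<^sup>2 * (v + w))) / (1 - x)"
    by (simp add: sum_divide_distrib[symmetric] sum_subtractf sum_distrib_right)
  finally show ?thesis
    using l by (simp add: zero_le_mult_iff)
qed

text \<open>This stands in for conditioning on a random choice with finitely many values:
  \<open>E B\<close> is the event that \<open>B\<close> is chosen, \<open>F B\<close> the error for
  fixed \<open>B\<close>. The probabilities of the disjoint \<open>E B\<close> add up to at most
  1.\<close>

lemma (in prob_space) prob_Union_indep_pairs_le: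
  assumes fin: "finite \<B>" and E: "\<And>B. B \<in> \<B> \<Longrightarrow> E B \<in> events" and F: "\<And>B. B \<in> \<B> \<Longrightarrow> F B \<in> events"
    and disj: "disjoint_family_on E \<B>"
    and ind: "\<And>B. B \<in> \<B> \<Longrightarrow> prob (E B \<inter> F B) = prob (E B) * prob (F B)"
    and le: "\<And>B. B \<in> \<B> \<Longrightarrow> prob (F B) \<le> \<beta>" and \<beta>: "\<beta> \<ge> 0"
  shows "prob (\<Union>B\<in>\<B>. E B \<inter> F B) \<le> \<beta>"
proof -
  have "prob (\<Union>B\<in>\<B>. E B \<inter> F B) \<le> (\<Sum>B\<in>\<B>. prob (E B \<inter> F B))"
    using fin E F by (intro finite_measure_subadditive_finite) auto
  also have "\<dots> \<le> (\<Sum>B\<in>\<B>. prob (E B) * \<beta>)"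
    by (intro sum_mono) (simp add: ind le mult_left_mono)
  also have "\<dots> = prob (\<Union>B\<in>\<B>. E B) * \<beta>"
    using fin E disj by (subst finite_measure_finite_Union) (auto simp: sum_distrib_right)
  also have "\<dots> \<le> 1 * \<beta>"
    using \<beta> by (intro mult_right_mono) auto
  finally show ?thesis by simp
qed

section \<open>Signal captured by the selected coordinates\<close>

lemma powr_half_diff_le:
  fixes x y p :: real
  assumes p: "p \<ge> 1"
  shows "(\<bar>x - y\<bar> / 2) powr p \<le> (\<bar>x\<bar> powr p + \<bar>y\<bar> powr p) / 2"
proof -
  have half: "(z / 2) powr p \<le> z powr p / 2" if "z \<ge> 0" for z :: real
  proof -
    have "(1 / 2) powr p \<le> (1 / 2 :: real) powr 1" using p by (intro powr_mono') auto
    then show ?thesis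
      using that mult_left_mono[of "(1 / 2) powr p" "1 / 2" "z powr p"] powr_mult[of z "1 / 2" p] by simp
  qed
  have "(\<bar>x - y\<bar> / 2) powr p \<le> ((\<bar>x\<bar> + \<bar>y\<bar>) / 2) powr p"
    using p by (intro powr_mono2) auto
  also have "\<dots> \<le> (\<bar>x\<bar> powr p + \<bar>y\<bar> powr p) / 2"
  proof (cases "x = 0 \<or> y = 0")
    case True then show ?thesis using half[of "\<bar>x\<bar>"] half[of "\<bar>y\<bar>"] by auto
  next
    case False
    then show ?thesis
      using convex_onD[OF powr_convex[OF p], of "1 / 2" "\<bar>x\<bar>" "\<bar>y\<bar>"] by (simp add: field_simps)
  qed
  finally show ?thesis .
qed

text \<open>The body is convex and symmetric, so half the difference of two of its points lies in it
  again; this is the origin of the factor 2 in \<open>q\<close>.\<close>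

lemma Gamma_set_half_difference:
  assumes "1 \<le> p" and a_pos: "\<And>t. t \<ge> 1 \<Longrightarrow> a t > 0"
    and g: "\<theta>1 \<in> Gamma_set a p" "\<theta>2 \<in> Gamma_set a p"
  defines "q \<equiv> \<lambda>t. (\<bar>\<theta>1 t - \<theta>2 t\<bar> / (2 * a t)) powr p"
  shows "summable (\<lambda>t. q (Suc t))" "(\<Sum>t. q (Suc t)) \<le> 1"
proof -
  let ?h = "\<lambda>t. (\<bar>\<theta>1 (Suc t)\<bar> powr p / a (Suc t) powr p + \<bar>\<theta>2 (Suc t)\<bar> powr p / a (Suc t) powr p) / 2"
  have le: "q (Suc t) \<le> ?h t" for t
  proof -
    have "q (Suc t) = (\<bar>\<theta>1 (Suc t) - \<theta>2 (Suc t)\<bar> / 2) powr p / a (Suc t) powr p"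
      using a_pos[of "Suc t"] by (simp add: q_def powr_divide[symmetric])
    also have "\<dots> \<le> (\<bar>\<theta>1 (Suc t)\<bar> powr p + \<bar>\<theta>2 (Suc t)\<bar> powr p) / 2 / a (Suc t) powr p"
      by (intro divide_right_mono powr_half_diff_le assms) auto
    finally show ?thesis by (simp add: add_divide_distrib)
  qed
  have h: "summable ?h" "suminf ?h \<le> 1"
    using g unfolding Gamma_set_def
    by (auto intro!: summable_divide summable_add simp: suminf_divide suminf_add[symmetric] summable_add)
  show s: "summable (\<lambda>t. q (Suc t))"
    by (rule summable_comparison_test'[OF h(1), of 0]) (use le in \<open>auto simp: q_def\<close>)
  show "(\<Sum>t. q (Suc t)) \<le> 1"
    using suminf_le[OF le s h(1)] h(2) by simp
qed

lemma Gamma_set_half_difference_sum_le: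
  assumes "1 \<le> p" "\<And>t. t \<ge> 1 \<Longrightarrow> a t > 0" "\<theta>1 \<in> Gamma_set a p" "\<theta>2 \<in> Gamma_set a p"
    and A: "finite A" "A \<subseteq> {1..}"
  shows "(\<Sum>t\<in>A. (\<bar>\<theta>1 t - \<theta>2 t\<bar> / (2 * a t)) powr p) \<le> 1"
proof -
  let ?q = "\<lambda>t. (\<bar>\<theta>1 t - \<theta>2 t\<bar> / (2 * a t)) powr p"
  have bij: "A = Suc ` ((\<lambda>t. t - 1) ` A)"
  proof -
    have "Suc (t - 1) = t" if "t \<in> A" for t using A(2) that by fastforce
    then show ?thesis by (auto simp: image_image image_iff)
  qed
  have "(\<Sum>t\<in>A. ?q t) = (\<Sum>t\<in>(\<lambda>t. t - 1) ` A. ?q (Suc t))"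
    by (subst bij, subst sum.reindex) auto
  also have "\<dots> \<le> (\<Sum>t. ?q (Suc t))"
    using A(1) by (intro sum_le_suminf Gamma_set_half_difference assms) auto
  also have "\<dots> \<le> 1"
    by (intro Gamma_set_half_difference assms)
  finally show ?thesis .
qed

text \<open>No coordinate of the half difference exceeds \<open>a t\<close>, so its ratio z to
  \<open>a t\<close> is at most 1, and p \<le> 2 gives z^2 \<le> z^p. Hence the squares beyond r
  cost at most 4\<alpha>^2 times a budget of 1.\<close>

lemma l2dist_head_bound:
  assumes p: "1 \<le> p" "p \<le> 2" and a_pos: "\<And>t. t \<ge> 1 \<Longrightarrow> a t > 0"
    and g: "\<theta>1 \<in> Gamma_set a p" "\<theta>2 \<in> Gamma_set a p"
    and tail: "\<And>t. t > r \<Longrightarrow> a t \<le> \<alpha>"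
    and eps: "0 < \<epsilon>" "\<epsilon> \<le> l2dist \<theta>1 \<theta>2"
  shows "\<epsilon>\<^sup>2 \<le> (\<Sum>t\<in>{1..r}. (\<theta>1 t - \<theta>2 t)\<^sup>2) + 4 * \<alpha>\<^sup>2"
proof -
  let ?q = "\<lambda>t. (\<bar>\<theta>1 t - \<theta>2 t\<bar> / (2 * a t)) powr p"
  let ?d = "\<lambda>t. (\<theta>1 (Suc t) - \<theta>2 (Suc t))\<^sup>2"
  note q = Gamma_set_half_difference[OF p(1) a_pos g]
  have q1: "?q t \<le> 1" if "t \<ge> 1" for t
    using Gamma_set_half_difference_sum_le[OF p(1) a_pos g, of "{t}"] that by auto
  have le: "?d (t + r) \<le> 4 * \<alpha>\<^sup>2 * ?q (Suc (t + r))" for t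
  proof -
    let ?t = "Suc (t + r)"
    have a: "a ?t > 0" "a ?t \<le> \<alpha>" using a_pos tail by auto
    define z where "z = \<bar>\<theta>1 ?t - \<theta>2 ?t\<bar> / (2 * a ?t)"
    have z0: "z \<ge> 0" using a by (simp add: z_def)
    have "z powr p \<le> 1" using q1[of ?t] by (simp add: z_def)
    then have "\<not> 1 < z" using p gr_one_powr[of z p] by linarith
    then have "z \<le> 1" by simp
    then have "z powr 2 \<le> z powr p" using z0 p by (intro powr_mono') auto
    then have zp: "z\<^sup>2 \<le> z powr p" using z0 by (cases "z = 0") (auto simp: powr_numeral)
    have "?d (t + r) = 4 * (a ?t)\<^sup>2 * z\<^sup>2"
      using a by (simp add: z_def power_divide power_mult_distrib)
    also have "\<dots> \<le> 4 * \<alpha>\<^sup>2 * z powr p"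
      using a zp by (intro mult_mono power_mono) auto
    finally show ?thesis by (simp add: z_def)
  qed
  have sq: "summable (\<lambda>t. 4 * \<alpha>\<^sup>2 * ?q (Suc (t + r)))"
    using q(1) by (intro summable_mult) (simp add: summable_iff_shift[of "\<lambda>t. ?q (Suc t)"])
  have sr: "summable (\<lambda>t. ?d (t + r))"
    by (rule summable_comparison_test'[OF sq, of 0]) (use le in auto)
  \<comment> \<open>\<open>l2dist\<close> is built on \<open>suminf\<close>, so summability has to
    be known before the series can be split; it follows from the bound on the tail.\<close>
  then have s: "summable ?d" by (subst (asm) summable_iff_shift)
  have "(\<Sum>t. ?d (t + r)) \<le> (\<Sum>t. 4 * \<alpha>\<^sup>2 * ?q (Suc (t + r)))"
    by (rule suminf_le[OF le sr sq])
  also have "\<dots> = 4 * \<alpha>\<^sup>2 * (\<Sum>t. ?q (Suc (t + r)))"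
    using q(1) by (intro suminf_mult) (simp add: summable_iff_shift[of "\<lambda>t. ?q (Suc t)"])
  also have "(\<Sum>t. ?q (Suc (t + r))) \<le> (\<Sum>t. ?q (Suc t))"
    using suminf_split_initial_segment[OF q(1), of r] by (simp add: sum_nonneg)
  also note q(2)
  finally have tl: "(\<Sum>t. ?d (t + r)) \<le> 4 * \<alpha>\<^sup>2" by (simp add: mult_left_mono)
  have "\<epsilon> \<le> sqrt (suminf ?d)" using eps by (simp add: l2dist_def)
  then have "\<epsilon>\<^sup>2 \<le> (sqrt (suminf ?d))\<^sup>2"
    using eps by (intro power_mono) auto
  also have "\<dots> = suminf ?d"
    using s by (simp add: suminf_nonneg)
  also have "\<dots> = (\<Sum>t. ?d (t + r)) + sum ?d {..<r}"
    by (rule suminf_split_initial_segment[OF s])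
  also have "sum ?d {..<r} = (\<Sum>t\<in>{1..r}. (\<theta>1 t - \<theta>2 t)\<^sup>2)"
    by (rule sum.reindex_bij_witness[of _ "\<lambda>t. t - 1" Suc]) auto
  finally show ?thesis using tl by simp
qed

section \<open>The cutoffs D and d_u, and the coordinates beyond them\<close>

lemma Dc_spec:
  assumes "a \<longlonglongrightarrow> 0" "\<epsilon> > 0"
  shows "Dc a \<epsilon> \<ge> 1" "a (Dc a \<epsilon>) \<le> \<epsilon> / 3"
proof -
  have "eventually (\<lambda>n. a n < \<epsilon> / 3 \<and> n \<ge> 1) sequentially"
    using order_tendstoD(2)[OF assms(1), of "\<epsilon> / 3"] assms(2) eventually_ge_at_top[of 1]
    by (auto intro: eventually_conj)
  then obtain n where "a n \<le> \<epsilon> / 3" "n \<ge> 1"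
    by (auto simp: eventually_sequentially intro: less_imp_le)
  then have "Dc a \<epsilon> \<ge> 1 \<and> a (Dc a \<epsilon>) \<le> \<epsilon> / 3"
    unfolding Dc_def by (intro LeastI[where P = "\<lambda>d. d \<ge> 1 \<and> a d \<le> \<epsilon> / 3"]) auto
  then show "Dc a \<epsilon> \<ge> 1" "a (Dc a \<epsilon>) \<le> \<epsilon> / 3" by auto
qed

text \<open>Since a_t tends to 0, the set in the definition of \<open>d_u\<close> is finite, so its
  \<open>Max\<close> is a true maximum and a larger index violates the defining inequality. The
  adjoined 0 covers the empty case.\<close>

lemma above_d_u:
  fixes a :: "nat \<Rightarrow> real" and p \<epsilon> :: real and n :: nat
  assumes p: "1 \<le> p" and a_pos: "\<And>t. t \<ge> 1 \<Longrightarrow> a t > 0" and a_lim: "a \<longlonglongrightarrow> 0"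
    and K: "K = (\<epsilon>\<^sup>2 / 9) / (576 * ln (4 * real (Dc a \<epsilon>) / delta))" "K > 0"
    and n: "n \<ge> 1" and t: "t > d_u a p n \<epsilon>"
  shows "a t powr p < K * real n powr ((2 - p) / 2)"
proof -
  let ?c = "real n powr ((p - 2) / 2)"
  let ?A = "{d. d \<ge> 1 \<and> a d powr p * ?c \<ge> K}"
  have c: "?c > 0" using n by simp
  have "(\<lambda>d. \<bar>a d\<bar> powr p * ?c) \<longlonglongrightarrow> \<bar>0\<bar> powr p * ?c"
    using p by (intro tendsto_intros tendsto_powr' a_lim) auto
  then have "eventually (\<lambda>d. \<bar>a d\<bar> powr p * ?c < K) sequentially"
    using K(2) by (intro order_tendstoD) auto
  then obtain m where m: "\<And>d. d \<ge> m \<Longrightarrow> \<bar>a d\<bar> powr p * ?c < K"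
    by (auto simp: eventually_sequentially)
  have "?A \<subseteq> {..m}"
  proof
    fix d assume d: "d \<in> ?A"
    then have "\<bar>a d\<bar> = a d" using a_pos[of d] by auto
    then show "d \<in> {..m}" using d m[of d] by (cases "d \<le> m") auto
  qed
  then have "finite ?A" by (rule finite_subset) auto
  then have "t \<notin> ?A"
    using t Max_ge[of "{0} \<union> ?A" t] unfolding d_u_def K(1)[symmetric] by fastforce
  then have "a t powr p * ?c < K" using t by auto
  then have "a t powr p < K / ?c" using c by (simp add: field_simps)
  also have "\<dots> = K * real n powr (- ((p - 2) / 2))"
    by (simp only: powr_minus divide_inverse)
  also have "- ((p - 2) / 2) = (2 - p) / 2" by (simp only: minus_divide_left minus_diff_eq)
  finally show ?thesis .
qed

text \<open>A coordinate that passes the screening uses more than 1/(K n) of the total budget 1, so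
  there are at most K n of them. The powers combine by n^((2-p)/2) n^(p/2) = n and 4^(p/2) =
  2^p.\<close>

lemma half_difference_powr_gt:
  fixes d a p n L K :: real
  assumes p: "1 \<le> p" and a: "a > 0" "a powr p < K * n powr ((2 - p) / 2)"
    and n: "n \<ge> 1" and L: "L \<ge> 2" and d: "\<bar>d\<bar> \<ge> sqrt (2 * L / n)"
  shows "1 / (K * n) < (\<bar>d\<bar> / (2 * a)) powr p"
proof -
  have "0 < K * n powr ((2 - p) / 2)"
    using a(2) powr_ge_zero[of a p] by linarith
  then have K: "K > 0"
    using n by (simp add: zero_less_mult_iff)
  have "(4 / n) powr (p / 2) = sqrt (4 / n) powr p"
    using n by (simp add: powr_half_sqrt[symmetric] powr_powr)
  also have "\<dots> \<le> \<bar>d\<bar> powr p"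
  proof (rule powr_mono2)
    have "sqrt (4 / n) \<le> sqrt (2 * L / n)"
      using L n by (intro real_sqrt_le_mono divide_right_mono) auto
    then show "sqrt (4 / n) \<le> \<bar>d\<bar>" using d by linarith
  qed (use p n in auto)
  finally have dp: "(4 / n) powr (p / 2) \<le> \<bar>d\<bar> powr p" .
  have "(4::real) powr (p / 2) = (2 powr 2) powr (p / 2)" by simp
  also have "\<dots> = 2 powr p" using powr_powr[of 2 2 "p / 2"] by simp
  finally have four: "(4::real) powr (p / 2) = 2 powr p" .
  have nn: "n powr ((2 - p) / 2) * n powr (p / 2) = n"
    using n by (simp add: powr_add[symmetric] add_divide_distrib[symmetric])
  have "(2 * a) powr p = 2 powr p * a powr p"
    by (rule powr_mult)
  also have "\<dots> < 2 powr p * (K * n powr ((2 - p) / 2))"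
    using a by (intro mult_strict_left_mono) auto
  finally have ap: "(2 * a) powr p < 2 powr p * (K * n powr ((2 - p) / 2))" .
  have "1 / (K * n) = 1 / (K * (n powr ((2 - p) / 2) * n powr (p / 2)))"
    by (simp only: nn)
  also have "\<dots> = (4 / n) powr (p / 2) / (2 powr p * (K * n powr ((2 - p) / 2)))"
    by (simp add: powr_divide four)
  also have "\<dots> < (4 / n) powr (p / 2) / (2 * a) powr p"
    using ap n K a by (intro divide_strict_left_mono mult_pos_pos) auto
  also have "\<dots> \<le> \<bar>d\<bar> powr p / (2 * a) powr p"
    using dp by (intro divide_right_mono) auto
  also have "\<dots> = (\<bar>d\<bar> / (2 * a)) powr p"
    using a by (simp add: powr_divide)
  finally show ?thesis .
qed

text \<open>Interpolation d^2 = |d|^p |d|^(2-p): the first factor is charged to the budget through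
  the bound on a^p, the second is bounded by the screening level. All powers of n cancel, so the
  discarded squares sum to at most C K, whatever their number.\<close>

lemma square_le_half_difference_powr:
  fixes d a p n C K :: real
  assumes p: "1 \<le> p" "p \<le> 2" and a: "a > 0" "a powr p < K * n powr ((2 - p) / 2)"
    and n: "n \<ge> 1" and C: "C \<ge> 4" and d: "\<bar>d\<bar> \<le> sqrt (C / n)" and K: "K > 0"
  shows "d\<^sup>2 \<le> C * K * (\<bar>d\<bar> / (2 * a)) powr p"
proof (cases "d = 0")
  case True then show ?thesis using C K by simp
next
  case False
  let ?q = "(\<bar>d\<bar> / (2 * a)) powr p"
  have "(2::real) powr p = (2 powr 2) powr (p / 2)" using powr_powr[of 2 2 "p / 2"] by simp
  also have "\<dots> \<le> C powr (p / 2)" using C p by (intro powr_mono2) auto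
  finally have two: "2 powr p \<le> C powr (p / 2)" .
  have "\<bar>d\<bar> powr (2 - p) \<le> sqrt (C / n) powr (2 - p)"
    using d p by (intro powr_mono2) auto
  also have "\<dots> = C powr ((2 - p) / 2) / n powr ((2 - p) / 2)"
    using C n by (simp add: powr_half_sqrt[symmetric] powr_powr powr_divide)
  finally have d2p: "\<bar>d\<bar> powr (2 - p) \<le> C powr ((2 - p) / 2) / n powr ((2 - p) / 2)" .
  have "\<bar>d\<bar> powr p = ?q * (2 * a) powr p"
    using a by (simp add: powr_divide)
  also have "\<dots> = ?q * (2 powr p * a powr p)"
    using a by (simp add: powr_mult)
  also have "\<dots> \<le> ?q * (C powr (p / 2) * (K * n powr ((2 - p) / 2)))"
    using a two by (intro mult_left_mono mult_mono) auto
  finally have dp: "\<bar>d\<bar> powr p \<le> ?q * (C powr (p / 2) * (K * n powr ((2 - p) / 2)))" .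
  have "d\<^sup>2 = \<bar>d\<bar> powr 2" using False by (simp add: powr_numeral)
  also have "\<dots> = \<bar>d\<bar> powr p * \<bar>d\<bar> powr (2 - p)" using False by (simp add: powr_add[symmetric])
  also have "\<dots> \<le> ?q * (C powr (p / 2) * (K * n powr ((2 - p) / 2)))
      * (C powr ((2 - p) / 2) / n powr ((2 - p) / 2))"
    using dp d2p K by (intro mult_mono) auto
  also have "\<dots> = ?q * K * (C powr (p / 2) * C powr ((2 - p) / 2))"
    using n by simp
  also have "C powr (p / 2) * C powr ((2 - p) / 2) = C"
    using C by (simp add: powr_add[symmetric] field_simps)
  finally show ?thesis by (simp add: mult.commute mult.left_commute)
qed

text \<open>Put b = a sqrt n. Then b^p < K n \<le> 1 forces b \<le> 1, and p \<le> 2 gives b^2 \<le>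
  b^p < K n.\<close>

lemma square_less_if_small:
  fixes a p n K :: real
  assumes p: "1 \<le> p" "p \<le> 2" and a: "a > 0" "a powr p < K * n powr ((2 - p) / 2)"
    and n: "n \<ge> 1" and Kn: "K * n \<le> 1"
  shows "a\<^sup>2 < K"
proof -
  let ?b = "a * sqrt n"
  have nn: "n powr ((2 - p) / 2) * n powr (p / 2) = n"
    using n by (simp add: powr_add[symmetric] field_simps)
  have "?b powr p = a powr p * n powr (p / 2)"
    using a n by (simp add: powr_mult powr_half_sqrt[symmetric] powr_powr)
  also have "\<dots> < K * n powr ((2 - p) / 2) * n powr (p / 2)"
    using a n by (intro mult_strict_right_mono) auto
  also have "\<dots> = K * n" using nn by (simp add: mult.assoc)
  finally have b: "?b powr p < K * n" .
  have b0: "?b > 0" using a n by simp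
  have "?b \<le> 1"
    using b Kn p powr_mono2[of p 1 ?b] by (cases "?b \<le> 1") auto
  then have "?b powr 2 \<le> ?b powr p" using b0 p by (intro powr_mono') auto
  moreover have "?b powr 2 = a\<^sup>2 * n" using b0 n by (simp add: power_mult_distrib)
  ultimately have "a\<^sup>2 * n < K * n" using b by linarith
  then show ?thesis using n by simp
qed

text \<open>In the next two lemmas $V$, $W$, $s$ are the variances of the second-half means and of the
  mean of $Z$ and the captured signal, all divided by $\epsilon^2$.\<close>

lemma exponent_bound_few_samples:
  fixes V W s x :: real and d :: nat
  assumes V: "V > 0" "V * sqrt d \<le> 1 / 16" and W: "W > 0" "W \<le> 1 / 32" and VW: "V * W * d \<le> 1 / 256"
    and d: "d \<ge> 1" and s: "s \<ge> 999 / 1000" and x: "x = 36 * V * (V + 2 * W)"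
  shows "6 * V + 36 * W * V < 1" "x < 1" "d * x / 2 - s * (3 - 18 * (V + W)) \<le> - (141 / 100) * (1 - x)"
proof -
  have "V * 1 \<le> V * sqrt d" using V d by (intro mult_left_mono real_sqrt_ge_one) auto
  then have V1: "V \<le> 1 / 16" using V by linarith
  have VW1: "V * W \<le> 1 / 16 * (1 / 32)" using V1 V W by (intro mult_mono) auto
  have V2: "V * V \<le> 1 / 16 * (1 / 16)" using V1 V by (intro mult_mono) auto
  show "6 * V + 36 * W * V < 1" using V1 VW1 by (simp add: mult.commute)
  have xe: "x = 36 * (V * V) + 72 * (V * W)" unfolding x by (simp add: algebra_simps)
  show "x < 1" using VW1 V2 xe by simp
  have x0: "x \<ge> 0" using V W x by simp
  have E0: "3 - 18 * (V + W) \<ge> 0" using V1 W by simp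
  have sE: "s * (3 - 18 * (V + W)) \<ge> 999 / 1000 * (3 - 18 * (V + W))"
    using s E0 by (intro mult_right_mono) auto
  show "d * x / 2 - s * (3 - 18 * (V + W)) \<le> - (141 / 100) * (1 - x)"
  proof (cases "d = 1")
    case True
    \<comment> \<open>After collecting terms, x appears as (1/2 - 141/100) x, so a lower bound on x
      is needed. It is linearized at the worst corner V = 1/16, W = 1/32, where the factor 1-x
      cannot be given away.\<close>
    have p1: "0 \<le> (1 / 16 - V) * (1 / 16 - V)" by simp
    have p2: "0 \<le> (1 / 16 - V) * (1 / 32 - W)" using V1 W by (intro mult_nonneg_nonneg) auto
    have "x \<ge> 36 * (V / 8 - 1 / 256) + 72 * (W / 16 + V / 32 - 1 / 512)"
      using p1 p2 unfolding xe by (simp add: algebra_simps)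
    then have "x / 2 - s * (3 - 18 * (V + W)) \<le> - (141 / 100) * (1 - x)"
      using sE V1 W by (simp add: field_simps)
    then show ?thesis using True by simp
  next
    case False
    then have d2: "real d \<ge> 2" using d by simp
    \<comment> \<open>For d \<ge> 2 the smaller V pays for dropping the gain from 1-x: V \<le> 5/112
      and d x \<le> 108/256 leave an exponent of at most -1.42, the tightest of all cases.\<close>
    have "7 / 5 \<le> sqrt (real d)" using d2 by (intro real_le_rsqrt) (simp add: power2_eq_square)
    then have "V * (7 / 5) \<le> V * sqrt d" using V by (intro mult_left_mono) auto
    then have V3: "V \<le> 5 / 112" using V(2) by linarith
    have "(V * sqrt d)\<^sup>2 \<le> (1 / 16)\<^sup>2" using V by (intro power_mono) auto
    moreover have "(V * sqrt d)\<^sup>2 = V * V * d"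
      by (simp add: power_mult_distrib) (simp add: power2_eq_square)
    ultimately have "V * V * d \<le> 1 / 256" by (simp add: power_divide)
    then have "d * x \<le> 36 * (1 / 256) + 72 * (1 / 256)" using VW unfolding xe by (simp add: algebra_simps)
    then show ?thesis using sE V3 W x0 by argo
  qed
qed

lemma exponent_bound_many_samples:
  fixes V W s x N M d u :: real
  assumes N: "N \<ge> 20736" and M: "M \<ge> 32" and V: "V > 0" "V \<le> 2 / N" and W: "W = 1 / M"
    and d: "0 \<le> d" "d \<le> u + N / 20736" and u: "u \<le> N\<^sup>2 / 1024" "u \<le> M * N / 512"
    and s: "s \<ge> 536 / 1000" and x: "x = 121 * V * (V + 2 * W)"
  shows "11 * V + 121 * W * V < 1" "x < 1" "d * x / 2 - s * (11 / 2 - 121 / 2 * (V + W)) \<le> - (141 / 100) * (1 - x)"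
proof -
  have N0: "N > 0" "M > 0" using N M by auto
  have W1: "W > 0" "W \<le> 1 / 32" using M unfolding W by (auto simp: field_simps)
  have iN: "1 / N \<le> 1 / 20736" using N by (simp add: field_simps)
  have V1: "V \<le> 1 / 10368" using V iN by simp
  have VW1: "V * W \<le> 1 / 10368 * (1 / 32)" using V1 V W1 by (intro mult_mono) auto
  have V2: "V * V \<le> 1 / 10368 * (1 / 10368)" using V1 V by (intro mult_mono) auto
  show "11 * V + 121 * W * V < 1" using V1 VW1 by (simp add: mult.commute)
  have xe: "x = 121 * (V * V) + 242 * (V * W)" unfolding x by (simp add: algebra_simps)
  show "x < 1" using VW1 V2 xe by simp
  have x0: "x \<ge> 0" using V W1 x by simp
  have sE: "s * (11 / 2 - 121 / 2 * (V + W)) \<ge> 536 / 1000 * (11 / 2 - 121 / 2 * (V + W))"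
    using s V1 W1 by (intro mult_right_mono) auto
  have "V * V \<le> (2 / N) * (2 / N)" "V * W \<le> (2 / N) * (1 / M)"
    using V N0 unfolding W by (intro mult_mono; simp)+
  then have "x \<le> 484 * (1 / N * (1 / N) + 1 / N * (1 / M))" unfolding xe by simp
  then have "d * x \<le> d * (484 * (1 / N * (1 / N) + 1 / N * (1 / M)))" using d by (intro mult_left_mono) auto
  also have "\<dots> \<le> (u + N / 20736) * (484 * (1 / N * (1 / N) + 1 / N * (1 / M)))"
    using d N0 by (intro mult_right_mono) auto
  also have "\<dots> = 484 * (u / N\<^sup>2) + 484 * (u / (M * N)) + 484 / 20736 * (1 / N + 1 / M)"
    using N0 by (simp add: field_simps power2_eq_square)
  also have "u / (M * N) \<le> 1 / 512" using u N0 by (simp add: field_simps)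
  also have "1 / N + 1 / M \<le> 1 / 20736 + 1 / 32" using iN W1(2) unfolding W by linarith
  finally have dx: "d * x \<le> 484 * (u / N\<^sup>2) + 484 / 512 + 484 / 20736 * (1 / 20736 + 1 / 32)" by simp
  show "d * x / 2 - s * (11 / 2 - 121 / 2 * (V + W)) \<le> - (141 / 100) * (1 - x)"
  \<comment> \<open>W = 1/32 together with u/N^2 = 1/1024 would be too much noise, but they exclude
    each other: if M \<le> 64, then u \<le> M N / 512 and the size of N make u/N^2 negligible;
    otherwise W is at most 1/64.\<close>
  proof (cases "M \<le> 64")
    case True
    have "u / N\<^sup>2 \<le> (M * N / 512) / N\<^sup>2" using u by (intro divide_right_mono) auto
    also have "\<dots> = M / 512 * (1 / N)" using N0 by (simp add: power2_eq_square)
    also have "\<dots> \<le> 64 / 512 * (1 / 20736)" using True N0 iN by (intro mult_mono) auto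
    finally show ?thesis using dx sE V1 W1 x0 by argo
  next
    case False
    have "W \<le> 1 / 64" using False unfolding W by (simp add: field_simps)
    moreover have "u / N\<^sup>2 \<le> 1 / 1024" using u N0 by (simp add: field_simps)
    ultimately show ?thesis using dx sE V1 W1 x0 by argo
  qed
qed

text \<open>Purely deterministic: \<open>B\<close> is any outcome of the screening that meets the
  two guarantees. The tilt is left existential because its choice depends on the size of K n, but
  the resulting exponent is the same for every \<open>B\<close>.\<close>

lemma selected_set_exponent:
  fixes a :: "nat \<Rightarrow> real" and p \<epsilon> :: real and n m :: nat and B :: "nat set"
  assumes p: "1 \<le> p" "p \<le> 2"
    and a_mono: "\<And>t. t \<ge> 1 \<Longrightarrow> a (Suc t) \<le> a t"
    and a_pos: "\<And>t. t \<ge> 1 \<Longrightarrow> a t > 0"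
    and a_lim: "a \<longlonglongrightarrow> 0"
    and eps: "\<epsilon> > 0"
    and n2: "n \<ge> 2"
    and hm: "real m \<ge> 32 / \<epsilon>\<^sup>2"
    and hn: "real n \<ge> 32 * sqrt (real (d_u a p n \<epsilon>)) / \<epsilon>\<^sup>2"
    and hmn: "real m * real n \<ge> 512 * real (d_u a p n \<epsilon>) / \<epsilon> ^ 4"
    and g: "\<theta>1 \<in> Gamma_set a p" "\<theta>2 \<in> Gamma_set a p" and sep: "\<epsilon> \<le> l2dist \<theta>1 \<theta>2"
    and B: "B \<subseteq> {d_u a p n \<epsilon> + 1..Dc a \<epsilon>}"
    and thr: "thr = 4 * sqrt (2 * ln (2 * real (Dc a \<epsilon>) / delta) / real n)"
    and B_large: "\<And>t. t \<in> B \<Longrightarrow> \<bar>\<theta>1 t - \<theta>2 t\<bar> \<ge> thr / 4"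
    and B_small: "\<And>t. t \<in> {d_u a p n \<epsilon> + 1..Dc a \<epsilon>} - B \<Longrightarrow> \<bar>\<theta>1 t - \<theta>2 t\<bar> \<le> 7 / 4 * thr"
    and T: "T = {1..d_u a p n \<epsilon>} \<union> B"
    and v: "0 < v" "v \<le> 2 / real n" and w: "w = 1 / real m"
  shows "\<exists>l>0. \<exists>x. 2 * l * v + 4 * l\<^sup>2 * w * v < 1 \<and> x = 4 * l\<^sup>2 * v * (v + 2 * w) \<and> x < 1 \<and>
    (real (card T) * x / 2 - (\<Sum>t\<in>T. (\<theta>1 t - \<theta>2 t)\<^sup>2) * (l - 2 * l\<^sup>2 * (v + w))) / (1 - x) \<le> - (141 / 100)"
proof -
  define D where "D = Dc a \<epsilon>"
  define du where "du = d_u a p n \<epsilon>"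
  define L where "L = ln (2 * real D / delta)"
  define L' where "L' = ln (4 * real D / delta)"
  define K where "K = (\<epsilon>\<^sup>2 / 9) / (576 * L')"
  define q where "q t = (\<bar>\<theta>1 t - \<theta>2 t\<bar> / (2 * a t)) powr p" for t
  define S where "S = (\<Sum>t\<in>T. (\<theta>1 t - \<theta>2 t)\<^sup>2)"
  have n0: "real n \<ge> 1" using n2 by simp
  have e2: "\<epsilon>\<^sup>2 > 0" using eps by simp
  have m0: "real m > 0" using hm divide_pos_pos[of 32, OF _ e2] by linarith
  have D: "D \<ge> 1" "a D \<le> \<epsilon> / 3"
    using Dc_spec[OF a_lim eps] by (auto simp: D_def)
  \<comment> \<open>As 2D/delta = 64 D, the logarithm is at least 6 ln 2 \<ge> 4; this yields K
    \<le> \<epsilon>^2/20736 with 20736 = 4 * 5184.\<close>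
  have "4 \<le> 6 * ln (2::real)" using ln2_ge_two_thirds by simp
  also have "\<dots> = ln (2 ^ 6)" by (subst ln_realpow) auto
  also have "\<dots> \<le> L" unfolding L_def using D by (subst ln_le_cancel_iff) (auto simp: delta_def)
  finally have L: "L \<ge> 4" .
  have LL: "L \<le> L'" unfolding L_def L'_def using D by (subst ln_le_cancel_iff) (auto simp: delta_def)
  have K0: "K > 0" using L LL e2 by (simp add: K_def)
  have KL: "5184 * L' * K = \<epsilon>\<^sup>2" using L LL by (simp add: K_def)
  have "5184 * 4 * K \<le> 5184 * L' * K" using L LL K0 by (intro mult_right_mono) auto
  then have K1: "20736 * K \<le> \<epsilon>\<^sup>2" using KL by simp
  have "5184 * L * K \<le> 5184 * L' * K" using LL K0 by (intro mult_right_mono) auto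
  then have K2: "5184 * (L * K) \<le> \<epsilon>\<^sup>2" using KL by (simp add: mult.assoc)
  have above: "a t powr p < K * real n powr ((2 - p) / 2)" if "t > du" for t
    using above_d_u[OF p(1) a_pos a_lim _ K0, of \<epsilon> n t] n2 that by (simp add: K_def L'_def D_def du_def)
  have qsum: "(\<Sum>t\<in>A. q t) \<le> 1" if "finite A" "A \<subseteq> {1..}" for A
    unfolding q_def by (rule Gamma_set_half_difference_sum_le[OF p(1) a_pos g that])
  have finB: "finite B" using B by (rule finite_subset) simp
  have Bdu: "t > du" if "t \<in> B" for t using B that by (auto simp: du_def)
  have thr4: "thr / 4 = sqrt (2 * L / n)" by (simp add: thr L_def D_def)
  have "7 / 4 * thr = 7 * sqrt (2 * L / n)" using thr4 by simp
  also have "\<dots> = sqrt (7\<^sup>2 * (2 * L / n))" by (subst real_sqrt_mult) simp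
  finally have thr7: "7 / 4 * thr = sqrt (98 * L / n)" by simp
  have qB: "1 / (K * n) < q t" if "t \<in> B" for t
    unfolding q_def using Bdu[OF that] B_large[OF that] L
    by (intro half_difference_powr_gt[OF p(1) a_pos above n0, where L = L]) (auto simp: thr4)
  have "card B * (1 / (K * n)) \<le> (\<Sum>t\<in>B. q t)"
    using sum_mono[of B "\<lambda>_. 1 / (K * n)" q] qB by (auto intro: less_imp_le)
  also have "\<dots> \<le> 1" using Bdu by (intro qsum finB) fastforce
  finally have cardB: "card B \<le> K * n" using K0 n0 by (simp add: field_simps)
  have T_disj: "{1..du} \<inter> B = {}" using Bdu by fastforce
  have S: "S = (\<Sum>t\<in>{1..du}. (\<theta>1 t - \<theta>2 t)\<^sup>2) + (\<Sum>t\<in>B. (\<theta>1 t - \<theta>2 t)\<^sup>2)"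
    unfolding S_def T using T_disj finB by (subst sum.union_disjoint) (auto simp: du_def)
  have cardT: "card T = du + card B"
    unfolding T using T_disj finB by (subst card_Un_disjoint) (auto simp: du_def)
  have hn': "32 * sqrt du \<le> n * \<epsilon>\<^sup>2" using hn e2 by (simp add: du_def field_simps)
  have hm': "32 \<le> m * \<epsilon>\<^sup>2" using hm e2 by (simp add: field_simps)
  have "\<epsilon> ^ 4 = \<epsilon>\<^sup>2 * \<epsilon>\<^sup>2" by (simp add: power2_eq_square power4_eq_xxxx)
  then have hmn': "512 * real du \<le> (m * \<epsilon>\<^sup>2) * (n * \<epsilon>\<^sup>2)"
    using hmn eps by (simp add: du_def field_simps)
  define V where "V = v / \<epsilon>\<^sup>2"
  define W where "W = w / \<epsilon>\<^sup>2"
  define s where "s = S / \<epsilon>\<^sup>2"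
  have V0: "V > 0" using v e2 by (simp add: V_def)
  have W: "W = 1 / (m * \<epsilon>\<^sup>2)" by (simp add: W_def w)
  have W0: "W > 0" using m0 e2 by (simp add: W)
  have W1: "W \<le> 1 / 32" using hm' m0 e2 unfolding W by (intro divide_left_mono) auto
  have "V \<le> (2 / n) / \<epsilon>\<^sup>2" unfolding V_def using v e2 by (intro divide_right_mono) auto
  then have V1: "V \<le> 2 / (n * \<epsilon>\<^sup>2)" by simp
  have ne: "n * \<epsilon>\<^sup>2 > 0" using n0 e2 by simp
  have me: "m * \<epsilon>\<^sup>2 > 0" using m0 e2 by simp
  \<comment> \<open>With l = c/\<epsilon>^2 every term becomes a function of the ratios V, W and s,
    so \<epsilon> disappears from the numerical estimates.\<close>
  have reduce: ?thesis
    if c: "c > 0" and 1: "2 * c * V + 4 * c\<^sup>2 * W * V < 1" and x: "x = 4 * c\<^sup>2 * V * (V + 2 * W)" "x < 1"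
      and 2: "card T * x / 2 - s * (c - 2 * c\<^sup>2 * (V + W)) \<le> - (141 / 100) * (1 - x)" for c x :: real
  proof -
    let ?l = "c / \<epsilon>\<^sup>2"
    have vV: "v = V * \<epsilon>\<^sup>2" and wW: "w = W * \<epsilon>\<^sup>2" and sS: "S = s * \<epsilon>\<^sup>2"
      using e2 by (auto simp: V_def W_def s_def)
    have a1: "2 * ?l * v + 4 * ?l\<^sup>2 * w * v = 2 * c * V + 4 * c\<^sup>2 * W * V"
      unfolding vV wW using eps by (simp add: power_divide power2_eq_square)
    have a2: "4 * ?l\<^sup>2 * v * (v + 2 * w) = x"
      unfolding vV wW x using eps by (simp add: power_divide power2_eq_square field_simps)
    have a3: "S * (?l - 2 * ?l\<^sup>2 * (v + w)) = s * (c - 2 * c\<^sup>2 * (V + W))"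
      unfolding vV wW sS using eps by (simp add: power_divide power2_eq_square field_simps)
    have "(card T * x / 2 - s * (c - 2 * c\<^sup>2 * (V + W))) / (1 - x) \<le> - (141 / 100)"
      using 2 x(2) by (simp add: pos_divide_le_eq)
    then have "?l > 0 \<and> (2 * ?l * v + 4 * ?l\<^sup>2 * w * v < 1 \<and> x = 4 * ?l\<^sup>2 * v * (v + 2 * w) \<and> x < 1 \<and>
        (real (card T) * x / 2 - S * (?l - 2 * ?l\<^sup>2 * (v + w))) / (1 - x) \<le> - (141 / 100))"
      unfolding a1 a2 a3 using c e2 1 x(2) by simp
    then show ?thesis unfolding S_def by blast
  qed
  show ?thesis
  proof (cases "K * n \<le> 1")
    case True
    \<comment> \<open>A selected coordinate would need more than 1/(K n) \<ge> 1 of a budget of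
      1.\<close>
    have "B = {}"
    proof (rule ccontr)
      assume "B \<noteq> {}"
      then obtain t where t: "t \<in> B" by auto
      have "1 \<le> 1 / (K * n)" using True K0 n0 by simp
      then show False using qB[OF t] qsum[of "{t}"] Bdu[OF t] by auto
    qed
    have "a t \<le> sqrt K" if "t > du" for t
      using square_less_if_small[OF p _ above[OF that] n0 True] that a_pos[of t]
      by (intro real_le_rsqrt) auto
    then have "\<epsilon>\<^sup>2 \<le> (\<Sum>t\<in>{1..du}. (\<theta>1 t - \<theta>2 t)\<^sup>2) + 4 * (sqrt K)\<^sup>2"
      by (intro l2dist_head_bound[OF p a_pos g _ eps sep]) auto
    then have S1: "\<epsilon>\<^sup>2 \<le> S + 4 * K" using K0 by (simp add: S \<open>B = {}\<close>)
    then have "999 / 1000 * \<epsilon>\<^sup>2 \<le> S" using K1 e2 by linarith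
    then have s: "s \<ge> 999 / 1000" unfolding s_def using e2 by (simp add: pos_le_divide_eq)
    \<comment> \<open>Otherwise T would be empty and carry no signal. This is what gives the
      hypothesis on n its force: n \<epsilon>^2 \<ge> 32.\<close>
    have du1: "du \<ge> 1"
    proof (rule ccontr)
      assume "\<not> du \<ge> 1"
      then have "S = 0" by (simp add: S \<open>B = {}\<close>)
      then show False using s by (simp add: s_def)
    qed
    have "V * sqrt du \<le> 2 / (n * \<epsilon>\<^sup>2) * sqrt du" using V1 by (intro mult_right_mono) auto
    also have "\<dots> \<le> 1 / 16" using hn' ne by (simp add: field_simps)
    finally have V2: "V * sqrt du \<le> 1 / 16" .
    have "V * W * du \<le> 2 / (n * \<epsilon>\<^sup>2) * (1 / (m * \<epsilon>\<^sup>2)) * du"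
      unfolding W using V1 me by (intro mult_right_mono) auto
    also have "\<dots> = 2 * du / ((m * \<epsilon>\<^sup>2) * (n * \<epsilon>\<^sup>2))" by simp
    also have "\<dots> \<le> 1 / 256" using hmn' mult_pos_pos[OF me ne] by (subst pos_divide_le_eq) auto
    finally have V3: "V * W * du \<le> 1 / 256" .
    note * = exponent_bound_few_samples[OF V0 V2 W0 W1 V3 du1 s refl]
    show ?thesis
      by (rule reduce[of 3 "36 * V * (V + 2 * W)"]) (use * in \<open>auto simp: cardT \<open>B = {}\<close>\<close>)
  next
    case False
    define N where "N = n * \<epsilon>\<^sup>2"
    have N: "N \<ge> 20736"
    proof -
      have "20736 * 1 \<le> 20736 * (K * n)" using False by simp
      also have "\<dots> \<le> \<epsilon>\<^sup>2 * n" using mult_right_mono[OF K1, of "real n"] by simp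
      finally show ?thesis by (simp add: N_def mult_ac)
    qed
    have "20736 * (K * n) \<le> N" using mult_right_mono[OF K1, of "real n"] by (simp add: N_def mult_ac)
    then have dle: "card T \<le> du + N / 20736" using cardB by (simp add: cardT)
    have "(32 * sqrt du)\<^sup>2 \<le> N\<^sup>2" using hn' by (intro power_mono) (auto simp: N_def)
    then have u1: "du \<le> N\<^sup>2 / 1024" by (simp add: power_mult_distrib)
    have u2: "du \<le> (m * \<epsilon>\<^sup>2) * N / 512" using hmn' by (simp add: N_def)
    have anti: "a t \<le> a D" if "t \<ge> D" for t
      using that by (induction t rule: dec_induct) (use D a_mono in \<open>auto intro: order_trans\<close>)
    \<comment> \<open>\<open>du\<close> may exceed D, and the test keeps all coordinates up to
      \<open>du\<close> even then; the maximum treats both orders alike.\<close>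
    have "\<epsilon>\<^sup>2 \<le> (\<Sum>t\<in>{1..max D du}. (\<theta>1 t - \<theta>2 t)\<^sup>2) + 4 * (\<epsilon> / 3)\<^sup>2"
    proof (rule l2dist_head_bound[OF p a_pos g _ eps sep])
      show "a t \<le> \<epsilon> / 3" if "t > max D du" for t using anti[of t] D that by simp
    qed
    also have "{1..max D du} = ({1..du} \<union> B) \<union> ({du + 1..D} - B)"
      using B by (auto simp: du_def D_def)
    also have "(\<Sum>t\<in>\<dots>. (\<theta>1 t - \<theta>2 t)\<^sup>2) = S + (\<Sum>t\<in>{du + 1..D} - B. (\<theta>1 t - \<theta>2 t)\<^sup>2)"
      unfolding S_def T using finB by (subst sum.union_disjoint) (auto simp: du_def)
    also have "(\<Sum>t\<in>{du + 1..D} - B. (\<theta>1 t - \<theta>2 t)\<^sup>2) \<le> (\<Sum>t\<in>{du + 1..D} - B. 98 * L * K * q t)"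
    proof (rule sum_mono)
      fix t assume t: "t \<in> {du + 1..D} - B"
      then have "\<bar>\<theta>1 t - \<theta>2 t\<bar> \<le> sqrt (98 * L / n)" using B_small[of t] thr7 by (simp add: du_def D_def)
      then show "(\<theta>1 t - \<theta>2 t)\<^sup>2 \<le> 98 * L * K * q t"
        unfolding q_def using t L K0
        by (intro square_le_half_difference_powr[OF p a_pos above n0]) auto
    qed
    also have "\<dots> = 98 * (L * K) * (\<Sum>t\<in>{du + 1..D} - B. q t)" by (simp add: sum_distrib_left mult.assoc)
    also have "\<dots> \<le> 98 * (L * K) * 1" using L K0 by (intro mult_left_mono qsum) auto
    finally have "\<epsilon>\<^sup>2 \<le> S + 98 * (L * K) + 4 * (\<epsilon> / 3)\<^sup>2" by simp
    moreover have "4 * (\<epsilon> / 3)\<^sup>2 = 4 / 9 * \<epsilon>\<^sup>2" by (simp add: power_divide)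
    \<comment> \<open>1 - 4/9 - 98/5184 is slightly above 0.536: the losses beyond D and through
      discarded coordinates. Here 98 = 2 * 7^2 comes from the level 7/4 \<open>thr\<close>.\<close>
    ultimately have "536 / 1000 * \<epsilon>\<^sup>2 \<le> S" using K2 e2 by linarith
    then have s: "s \<ge> 536 / 1000" unfolding s_def using e2 by (simp add: pos_le_divide_eq)
    note * = exponent_bound_many_samples[OF N hm' V0 V1[folded N_def] W _ dle u1 u2 s refl]
    show ?thesis
      by (rule reduce[of "11 / 2" "121 * V * (V + 2 * W)"]) (use * in \<open>auto simp: power_divide\<close>)
  qed
qed

section \<open>Independence of the sample means\<close>

text \<open>A finite product measure is determined by its values on boxes. Boxes with all sides but
  one equal to the whole line give the marginals, and then the joint law is the product of the
  marginals.\<close>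

lemma (in prob_space) indep_vars_if_box_probabilities:
  fixes X :: "'i \<Rightarrow> 'a \<Rightarrow> real"
  assumes fin: "finite I" "I \<noteq> {}" and rv: "\<And>i. i \<in> I \<Longrightarrow> random_variable borel (X i)"
    and N: "\<And>i. prob_space (N i)" "\<And>i. sets (N i) = sets borel"
    and box: "\<And>A. (\<And>i. i \<in> I \<Longrightarrow> A i \<in> sets borel) \<Longrightarrow>
      emeasure M {\<omega> \<in> space M. \<forall>i\<in>I. X i \<omega> \<in> A i} = (\<Prod>i\<in>I. emeasure (N i) (A i))"
  shows "indep_vars (\<lambda>_. borel) X I" "\<And>i. i \<in> I \<Longrightarrow> distr M borel (X i) = N i"
proof -
  interpret N: prob_space "N i" for i by (rule N)
  interpret P: product_sigma_finite N by unfold_locales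
  have sp: "space (N i) = UNIV" for i using N(2)[of i] sets_eq_imp_space_eq by fastforce
  show marginal: "distr M borel (X i) = N i" if i: "i \<in> I" for i
  proof (rule measure_eqI)
    fix A assume "A \<in> sets (distr M borel (X i))"
    then have A: "A \<in> sets borel" by simp
    have "emeasure (distr M borel (X i)) A = emeasure M {\<omega> \<in> space M. \<forall>j\<in>I. X j \<omega> \<in> (if j = i then A else UNIV)}"
      using i rv[OF i] A by (auto simp: emeasure_distr intro!: arg_cong[where f = "emeasure M"] split: if_splits)
    also have "\<dots> = (\<Prod>j\<in>I. emeasure (N j) (if j = i then A else UNIV))"
      using A by (intro box) auto
    also have "\<dots> = (\<Prod>j\<in>I. if j = i then emeasure (N i) A else 1)"
      using N.emeasure_space_1 by (intro prod.cong) (auto simp: sp)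
    also have "\<dots> = emeasure (N i) A" using i fin by (simp add: prod.delta)
    finally show "emeasure (distr M borel (X i)) A = emeasure (N i) A" .
  qed (simp add: N)
  have X: "random_variable (\<Pi>\<^sub>M i\<in>I. borel) (\<lambda>\<omega>. \<lambda>i\<in>I. X i \<omega>)"
    by (intro measurable_restrict rv)
  have "distr M (\<Pi>\<^sub>M i\<in>I. borel) (\<lambda>\<omega>. \<lambda>i\<in>I. X i \<omega>) = PiM I N"
  proof (rule P.PiM_eqI)
    show "sets (distr M (\<Pi>\<^sub>M i\<in>I. borel) (\<lambda>\<omega>. \<lambda>i\<in>I. X i \<omega>)) = sets (PiM I N)"
      using N by (simp cong: sets_PiM_cong)
    fix A assume A: "\<And>i. i \<in> I \<Longrightarrow> A i \<in> sets (N i)"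
    then have A': "\<And>i. i \<in> I \<Longrightarrow> A i \<in> sets borel" using N by simp
    have "emeasure (distr M (\<Pi>\<^sub>M i\<in>I. borel) (\<lambda>\<omega>. \<lambda>i\<in>I. X i \<omega>)) (Pi\<^sub>E I A)
      = emeasure M ((\<lambda>\<omega>. \<lambda>i\<in>I. X i \<omega>) -` Pi\<^sub>E I A \<inter> space M)"
      using A' fin by (intro emeasure_distr X sets_PiM_I_finite) auto
    also have "(\<lambda>\<omega>. \<lambda>i\<in>I. X i \<omega>) -` Pi\<^sub>E I A \<inter> space M = {\<omega> \<in> space M. \<forall>i\<in>I. X i \<omega> \<in> A i}"
      by (auto simp: PiE_iff)
    also have "emeasure M \<dots> = (\<Prod>i\<in>I. emeasure (N i) (A i))"
      using A' by (rule box)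
    finally show "emeasure (distr M (\<Pi>\<^sub>M i\<in>I. borel) (\<lambda>\<omega>. \<lambda>i\<in>I. X i \<omega>)) (Pi\<^sub>E I A)
      = (\<Prod>i\<in>I. emeasure (N i) (A i))" .
  qed (use fin in auto)
  also have "\<dots> = (\<Pi>\<^sub>M i\<in>I. distr M borel (X i))"
    using marginal by (intro PiM_cong) auto
  finally show "indep_vars (\<lambda>_. borel) X I"
    using fin rv by (subst indep_vars_iff_distr_eq_PiM') auto
qed

text \<open>The mean with index (j, t) reads only the variables keyed by {kind j} x I j x {t}. These
  key sets are disjoint: within one sample by \<open>disj\<close>, across samples by the first key.
  Independence is inherited by functions of disjoint groups, and a mean of c unit-variance normals
  has variance 1/c.\<close>

lemma (in prob_space) block_means:
  fixes X :: "'k \<times> 'i \<times> 't \<Rightarrow> 'a \<Rightarrow> real" and kind :: "'j \<Rightarrow> 'k" and I :: "'j \<Rightarrow> 'i set"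
  assumes ind: "indep_vars (\<lambda>_. borel) X F"
    and F: "\<And>j t. j \<in> J \<Longrightarrow> t \<in> T \<Longrightarrow> {kind j} \<times> I j \<times> {t} \<subseteq> F"
    and fin: "\<And>j. j \<in> J \<Longrightarrow> finite (I j)" "\<And>j. j \<in> J \<Longrightarrow> I j \<noteq> {}"
    and disj: "\<And>i j. i \<in> J \<Longrightarrow> j \<in> J \<Longrightarrow> i \<noteq> j \<Longrightarrow> kind i = kind j \<Longrightarrow> I i \<inter> I j = {}"
    and normal: "\<And>k i t. (k, i, t) \<in> F \<Longrightarrow> distributed M lborel (X (k, i, t)) (normal_density (\<mu> k t) 1)"
  defines "G \<equiv> \<lambda>(j, t) \<omega>. (\<Sum>i\<in>I j. X (kind j, i, t) \<omega>) / real (card (I j))"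
  shows "indep_vars (\<lambda>_. borel) G (J \<times> T)"
    "\<And>j t. j \<in> J \<Longrightarrow> t \<in> T \<Longrightarrow>
      distributed M lborel (G (j, t)) (normal_density (\<mu> (kind j) t) (sqrt (1 / real (card (I j)))))"
proof -
  define K where "K = (\<lambda>(j, t :: 't). {kind j} \<times> I j \<times> {t})"
  have "indep_vars (\<lambda>_. borel) (\<lambda>jt \<omega>. (\<lambda>g. (\<Sum>i\<in>I (fst jt). g (kind (fst jt), i, snd jt)) / real (card (I (fst jt))))
      (restrict (\<lambda>x. X x \<omega>) (K jt))) (J \<times> T)"
  proof (rule indep_vars_compose2[OF indep_vars_restrict[OF ind]])
    show "disjoint_family_on K (J \<times> T)"
      using disj by (fastforce simp: disjoint_family_on_def K_def)
    show "(\<lambda>g. (\<Sum>i\<in>I (fst jt). g (kind (fst jt), i, snd jt)) / real (card (I (fst jt))))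
        \<in> borel_measurable (\<Pi>\<^sub>M i\<in>K jt. borel)" if "jt \<in> J \<times> T" for jt
      by (intro borel_measurable_divide borel_measurable_sum measurable_component_singleton) (auto simp: K_def split: prod.split)
  qed (use F in \<open>fastforce simp: K_def\<close>)
  then show "indep_vars (\<lambda>_. borel) G (J \<times> T)"
    by (rule indep_vars_cong[THEN iffD1, rotated -1]) (auto simp: G_def K_def fun_eq_iff)
next
  fix j t assume jt: "j \<in> J" "t \<in> T"
  let ?c = "real (card (I j))"
  have c: "?c > 0" using fin jt by (simp add: card_gt_0_iff)
  have "indep_vars (\<lambda>_. borel) (\<lambda>i \<omega>. (\<lambda>g. g (kind j, i, t)) (restrict (\<lambda>x. X x \<omega>) {(kind j, i, t)})) (I j)"
    by (rule indep_vars_compose2[OF indep_vars_restrict[OF ind]])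
      (use F[OF jt] in \<open>auto simp: disjoint_family_on_def\<close>)
  then have "indep_vars (\<lambda>_. borel) (\<lambda>i. X (kind j, i, t)) (I j)" by simp
  then have "distributed M lborel (\<lambda>\<omega>. \<Sum>i\<in>I j. X (kind j, i, t) \<omega>)
      (normal_density (\<Sum>i\<in>I j. \<mu> (kind j) t) (sqrt (\<Sum>i\<in>I j. 1\<^sup>2)))"
    using F[OF jt] fin jt by (intro sum_indep_normal normal) auto
  then have "distributed M lborel (\<lambda>\<omega>. \<Sum>i\<in>I j. X (kind j, i, t) \<omega>) (normal_density (?c * \<mu> (kind j) t) (sqrt ?c))"
    by simp
  from normal_density_affine[OF this, of "1 / ?c" 0] c
  have "distributed M lborel (\<lambda>\<omega>. (\<Sum>i\<in>I j. X (kind j, i, t) \<omega>) / ?c)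
      (normal_density (\<mu> (kind j) t) (\<bar>1 / ?c\<bar> * sqrt ?c))"
    by simp
  moreover have "\<bar>1 / ?c\<bar> * sqrt ?c = sqrt (1 / ?c)"
    using c by (simp add: real_sqrt_divide real_div_sqrt field_simps)
  ultimately show "distributed M lborel (G (j, t)) (normal_density (\<mu> (kind j) t) (sqrt (1 / ?c)))"
    by (simp add: G_def)
qed

section \<open>The data measure and its coordinates\<close>

lemma prob_space_gauss_seq: "prob_space (gauss_seq \<theta>)"
  unfolding gauss_seq_def by (intro prob_space_PiM prob_space_normal_density) auto

lemma prob_space_lfht_measure: "prob_space (lfht_measure n m \<theta>1 \<theta>2 \<theta>)"
  unfolding lfht_measure_def
  by (intro prob_space_pair prob_space_PiM prob_space_gauss_seq)

lemma gauss_seq_component_measurable: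
  "t \<ge> 1 \<Longrightarrow> (\<lambda>x. x t) \<in> borel_measurable (gauss_seq \<theta>)"
  unfolding gauss_seq_def by (auto intro!: measurable_compose[OF measurable_component_singleton[of t]])

lemma gauss_seq_samples_measurable:
  assumes "i \<in> {1..n}" "t \<ge> 1"
  shows "(\<lambda>X. X i t) \<in> borel_measurable (PiM {1..n} (\<lambda>_. gauss_seq \<theta>))"
proof -
  have "(\<lambda>X. X i) \<in> PiM {1..n} (\<lambda>_. gauss_seq \<theta>) \<rightarrow>\<^sub>M gauss_seq \<theta>"
    by (rule measurable_component_singleton[OF assms(1)])
  from measurable_compose[OF this gauss_seq_component_measurable[OF assms(2)]] show ?thesis .
qed

lemma emeasure_gauss_seq_samples_box:
  fixes A :: "nat \<Rightarrow> nat \<Rightarrow> real set"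
  assumes A: "\<And>i t. A i t \<in> sets borel"
  shows "emeasure (PiM {1..n} (\<lambda>_. gauss_seq \<theta>))
      {X \<in> space (PiM {1..n} (\<lambda>_. gauss_seq \<theta>)). \<forall>i\<in>{1..n}. \<forall>t\<in>{1..q}. X i t \<in> A i t}
    = (\<Prod>i\<in>{1..n}. \<Prod>t\<in>{1..q}. emeasure (density lborel (normal_density (\<theta> t) 1)) (A i t))"
proof -
  interpret N: prob_space "density lborel (normal_density (\<theta> t) 1)" for t
    by (rule prob_space_normal_density) simp
  interpret P: product_prob_space "\<lambda>t. density lborel (normal_density (\<theta> t) 1)" "{1..}"
    by unfold_locales
  interpret S: prob_space "gauss_seq \<theta>" by (rule prob_space_gauss_seq)
  interpret Q: product_sigma_finite "\<lambda>_::nat. gauss_seq \<theta>" by unfold_locales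
  let ?C = "\<lambda>i. {x \<in> space (gauss_seq \<theta>). \<forall>t\<in>{1..q}. x t \<in> A i t}"
  have C: "?C i \<in> sets (gauss_seq \<theta>)" for i
  proof -
    have [measurable]: "(\<lambda>x. x t) \<in> borel_measurable (gauss_seq \<theta>)" if "t \<in> {1..q}" for t
      using that by (intro gauss_seq_component_measurable) auto
    note A[measurable]
    show ?thesis by measurable
  qed
  have "{X \<in> space (PiM {1..n} (\<lambda>_. gauss_seq \<theta>)). \<forall>i\<in>{1..n}. \<forall>t\<in>{1..q}. X i t \<in> A i t} = Pi\<^sub>E {1..n} ?C"
    unfolding space_PiM PiE_iff by (auto simp: PiE_iff extensional_def)
  then have "emeasure (PiM {1..n} (\<lambda>_. gauss_seq \<theta>))
      {X \<in> space (PiM {1..n} (\<lambda>_. gauss_seq \<theta>)). \<forall>i\<in>{1..n}. \<forall>t\<in>{1..q}. X i t \<in> A i t}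
      = (\<Prod>i\<in>{1..n}. emeasure (gauss_seq \<theta>) (?C i))"
    using C by (simp add: Q.emeasure_PiM)
  also have "\<dots> = (\<Prod>i\<in>{1..n}. \<Prod>t\<in>{1..q}. emeasure (density lborel (normal_density (\<theta> t) 1)) (A i t))"
    unfolding gauss_seq_def using A by (intro prod.cong refl P.emeasure_PiM_Collect) auto
  finally show ?thesis .
qed

text \<open>The three samples $X$, $Y$, $Z$ carry the labels 0, 1, 2.\<close>

definition lfht_coord :: "nat \<times> nat \<times> nat \<Rightarrow>
    ((nat \<Rightarrow> nat \<Rightarrow> real) \<times> (nat \<Rightarrow> nat \<Rightarrow> real)) \<times> (nat \<Rightarrow> nat \<Rightarrow> real) \<Rightarrow> real" where
  "lfht_coord = (\<lambda>(k, i, t) \<omega>.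
     (if k = 0 then fst (fst \<omega>) else if k = 1 then snd (fst \<omega>) else snd \<omega>) i t)"

lemma space_lfht_measure:
  "space (lfht_measure n m \<theta>1 \<theta>2 \<theta>) =
    (space (PiM {1..n} (\<lambda>_. gauss_seq \<theta>1)) \<times> space (PiM {1..n} (\<lambda>_. gauss_seq \<theta>2)))
      \<times> space (PiM {1..m} (\<lambda>_. gauss_seq \<theta>))"
  unfolding lfht_measure_def space_pair_measure ..

lemma ball_Sigma_012:
  "(\<forall>j\<in>Sigma {0, 1, 2} (\<lambda>k::nat. I k \<times> T). P j) \<longleftrightarrow>
   (\<forall>i\<in>I 0. \<forall>t\<in>T. P (0, i, t)) \<and> (\<forall>i\<in>I 1. \<forall>t\<in>T. P (1, i, t)) \<and> (\<forall>i\<in>I 2. \<forall>t\<in>T. P (2, i, t))"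
  by auto

lemma prod_Sigma_012:
  assumes "\<And>k. finite (I k)" "finite T"
  shows "(\<Prod>j\<in>Sigma {0, 1, 2} (\<lambda>k::nat. I k \<times> T). h j) =
    (\<Prod>i\<in>I 0. \<Prod>t\<in>T. h (0, i, t)) * ((\<Prod>i\<in>I 1. \<Prod>t\<in>T. h (1, i, t)) * (\<Prod>i\<in>I 2. \<Prod>t\<in>T. h (2, i, t)))"
proof -
  have "(\<Prod>j\<in>Sigma {0, 1, 2} (\<lambda>k::nat. I k \<times> T). h j) = (\<Prod>k\<in>{0, 1, 2}. \<Prod>x\<in>I k \<times> T. h (k, x))"
    using assms by (subst prod.Sigma) auto
  moreover have "(\<Prod>x\<in>I k \<times> T. h (k, x)) = (\<Prod>i\<in>I k. \<Prod>t\<in>T. h (k, i, t))" for k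
    unfolding prod.cartesian_product by (simp add: case_prod_beta)
  ultimately show ?thesis by simp
qed

text \<open>Flattening the nested product measure into one indexed family gives access to results on
  independent families. Keeping only q coordinates per sample makes the family finite, so box
  probabilities decide.\<close>

lemma lfht_coord_indep_normal:
  fixes n m q :: nat and \<theta>1 \<theta>2 \<theta> :: "nat \<Rightarrow> real"
  assumes "n \<ge> 1" "q \<ge> 1"
  defines "M \<equiv> lfht_measure n m \<theta>1 \<theta>2 \<theta>"
    and "\<mu> \<equiv> \<lambda>k::nat. if k = 0 then \<theta>1 else if k = 1 then \<theta>2 else \<theta>"
    and "F \<equiv> Sigma {0, 1, 2} (\<lambda>k::nat. {1..if k = 2 then m else n} \<times> {1..q})"
  shows "prob_space.indep_vars M (\<lambda>_. borel) lfht_coord F"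
    "\<And>k i t. (k, i, t) \<in> F \<Longrightarrow> distributed M lborel (lfht_coord (k, i, t)) (normal_density (\<mu> k t) 1)"
proof -
  interpret M: prob_space M unfolding M_def by (rule prob_space_lfht_measure)
  let ?S = "\<lambda>(n::nat) \<theta>. PiM {1..n} (\<lambda>_::nat. gauss_seq \<theta>)"
  interpret S: prob_space "?S k \<eta>" for k :: nat and \<eta> by (intro prob_space_PiM prob_space_gauss_seq)
  define N where "N = (\<lambda>(k, i::nat, t). density lborel (normal_density (\<mu> k t) 1))"
  have rv: "lfht_coord j \<in> borel_measurable M" if "j \<in> F" for j
  proof -
    obtain k i t where j: "j = (k, i, t)" by (cases j)
    show ?thesis
      using that unfolding j F_def M_def lfht_measure_def lfht_coord_def
      by (auto intro!: measurable_compose[OF measurable_fst] measurable_compose[OF measurable_snd]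
          gauss_seq_samples_measurable split: if_splits simp del: One_nat_def)
  qed
  have box: "emeasure M {\<omega> \<in> space M. \<forall>j\<in>F. lfht_coord j \<omega> \<in> A j} = (\<Prod>j\<in>F. emeasure (N j) (A j))"
    if A: "\<And>j. j \<in> F \<Longrightarrow> A j \<in> sets borel" for A
  proof -
    \<comment> \<open>Padding with \<open>UNIV\<close> outside F makes the sets measurable for all
      keys, as the box formula for the samples requires.\<close>
    define B where "B k i t = (if (k, i, t) \<in> F then A (k, i, t) else UNIV)" for k i t
    have B: "B k i t \<in> sets borel" for k i t using A by (auto simp: B_def)
    let ?E = "\<lambda>k n \<theta>. {X \<in> space (?S n \<theta>). \<forall>i\<in>{1..n}. \<forall>t\<in>{1..q}. X i t \<in> B k i t}"
    have E: "?E k n \<theta> \<in> sets (?S n \<theta>)" for k n \<theta>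
    proof -
      have [measurable]: "(\<lambda>X. X i t) \<in> borel_measurable (?S n \<theta>)" if "i \<in> {1..n}" "t \<in> {1..q}" for i t
        using that by (intro gauss_seq_samples_measurable) auto
      note B[measurable]
      show ?thesis by measurable
    qed
    have sp: "space M = (space (?S n \<theta>1) \<times> space (?S n \<theta>2)) \<times> space (?S m \<theta>)"
      unfolding M_def by (rule space_lfht_measure)
    have coords: "(\<forall>j\<in>F. lfht_coord j ((X, Y), Z) \<in> A j) \<longleftrightarrow>
        (\<forall>i\<in>{1..n}. \<forall>t\<in>{1..q}. X i t \<in> B 0 i t) \<and>
        (\<forall>i\<in>{1..n}. \<forall>t\<in>{1..q}. Y i t \<in> B 1 i t) \<and>
        (\<forall>i\<in>{1..m}. \<forall>t\<in>{1..q}. Z i t \<in> B 2 i t)" for X Y Z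
    proof -
      have "(\<forall>j\<in>F. lfht_coord j ((X, Y), Z) \<in> A j) \<longleftrightarrow> (\<forall>j\<in>F. lfht_coord j ((X, Y), Z) \<in> (\<lambda>(k, i, t). B k i t) j)"
        by (intro ball_cong) (auto simp: B_def)
      then show ?thesis unfolding F_def ball_Sigma_012 by (simp add: lfht_coord_def)
    qed
    have "{\<omega> \<in> space M. \<forall>j\<in>F. lfht_coord j \<omega> \<in> A j} = (?E 0 n \<theta>1 \<times> ?E 1 n \<theta>2) \<times> ?E 2 m \<theta>"
      by (simp only: sp set_eq_iff split_paired_All mem_Collect_eq mem_Times_iff coords fst_conv snd_conv) blast
    then have "emeasure M {\<omega> \<in> space M. \<forall>j\<in>F. lfht_coord j \<omega> \<in> A j}
        = emeasure (?S n \<theta>1 \<Otimes>\<^sub>M ?S n \<theta>2) (?E 0 n \<theta>1 \<times> ?E 1 n \<theta>2) * emeasure (?S m \<theta>) (?E 2 m \<theta>)"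
      unfolding M_def lfht_measure_def
      by (simp only:) (rule S.emeasure_pair_measure_Times[OF pair_measureI[OF E E] E])
    also have "emeasure (?S n \<theta>1 \<Otimes>\<^sub>M ?S n \<theta>2) (?E 0 n \<theta>1 \<times> ?E 1 n \<theta>2)
        = emeasure (?S n \<theta>1) (?E 0 n \<theta>1) * emeasure (?S n \<theta>2) (?E 1 n \<theta>2)"
      by (rule S.emeasure_pair_measure_Times[OF E E])
    also have "\<dots> * emeasure (?S m \<theta>) (?E 2 m \<theta>)
        = (\<Prod>j\<in>F. emeasure (N j) ((\<lambda>(k, i, t). B k i t) j))"
      unfolding F_def by (subst prod_Sigma_012)
        (auto simp: emeasure_gauss_seq_samples_box[OF B] N_def \<mu>_def mult.assoc simp del: One_nat_def)
    also have "\<dots> = (\<Prod>j\<in>F. emeasure (N j) (A j))"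
      by (intro prod.cong) (auto simp: B_def)
    finally show ?thesis .
  qed
  have "finite F" unfolding F_def by (intro finite_SigmaI finite_cartesian_product) auto
  moreover have "(0, 1, 1) \<in> F" using assms(1,2) by (simp add: F_def)
  ultimately have F: "finite F" "F \<noteq> {}" by auto
  have N: "prob_space (N j)" "sets (N j) = sets borel" for j
    by (auto simp: N_def split: prod.split intro: prob_space_normal_density)
  show "M.indep_vars (\<lambda>_. borel) lfht_coord F"
    by (rule M.indep_vars_if_box_probabilities(1)[OF F rv N box])
  fix k i t assume j: "(k, i, t) \<in> F"
  have "distr M borel (lfht_coord (k, i, t)) = N (k, i, t)"
    by (rule M.indep_vars_if_box_probabilities(2)[OF F rv N box j])
  moreover have "distr M lborel (lfht_coord (k, i, t)) = distr M borel (lfht_coord (k, i, t))"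
    by (rule distr_cong) auto
  ultimately show "distributed M lborel (lfht_coord (k, i, t)) (normal_density (\<mu> k t) 1)"
    using rv[OF j] by (auto simp: distributed_def N_def)
qed

section \<open>Error of the test\<close>

lemma (in prob_space) normal_difference_deviation_bound:
  assumes ind: "indep_var borel X borel Y" and u: "u > 0" and s: "s \<ge> 0"
    and X: "distributed M lborel X (normal_density \<mu> (sqrt u))"
    and Y: "distributed M lborel Y (normal_density \<nu> (sqrt u))"
  shows "prob {\<omega> \<in> space M. \<bar>X \<omega> - Y \<omega> - (\<mu> - \<nu>)\<bar> \<ge> s} \<le> 2 * exp (- s\<^sup>2 / (4 * u))"
proof -
  have "distributed M lborel (\<lambda>\<omega>. X \<omega> - Y \<omega>) (normal_density (\<mu> - \<nu>) (sqrt ((sqrt u)\<^sup>2 + (sqrt u)\<^sup>2)))"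
    using u by (intro diff_indep_normal[OF ind _ _ X Y]) auto
  then have "distributed M lborel (\<lambda>\<omega>. X \<omega> - Y \<omega>) (normal_density (\<mu> - \<nu>) (sqrt (2 * u)))"
    using u by simp
  from normal_deviation_bound[OF this _ s] u show ?thesis by simp
qed

lemma exp_minus_141_le: "exp (- (141 / 100)) + 1 / 256 \<le> (1 / 4 :: real)"
proof -
  \<comment> \<open>12 * 47/400 = 141/100, and at 47/400 the quadratic Taylor bound is sharp enough
    to survive the twelfth power. The target is 63/256 = 1/4 - 1/256.\<close>
  have "(1124 / 1000 :: real) \<le> exp (47 / 400)"
    using exp_lower_Taylor_quadratic[of "47 / 400 :: real"] by (simp add: power2_eq_square)
  then have "(1124 / 1000 :: real) ^ 12 \<le> exp (47 / 400) ^ 12"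
    by (intro power_mono) auto
  also have "\<dots> = exp (141 / 100)"
    by (simp flip: exp_of_nat_mult)
  finally have "256 / 63 \<le> exp (141 / 100 :: real)" by (simp add: power_divide)
  then have "exp (- (141 / 100)) \<le> (63 / 256 :: real)"
    unfolding exp_minus by (simp add: field_simps)
  then show ?thesis by simp
qed

text \<open>The squared deviation is 18 L / r and the difference has variance 2u \<le> 6/r, so a
  single failure has probability at most 2 exp(-3L/2). With exp L = 64 D, the factor exp(-L) pays
  for the union over at most D coordinates and exp(-L/2) \<le> 1/8 gives the constant.\<close>

lemma (in prob_space) screening_failure_bound:
  fixes G :: "nat \<times> nat \<Rightarrow> 'a \<Rightarrow> real" and \<theta>1 \<theta>2 :: "nat \<Rightarrow> real"
  assumes ind: "indep_vars (\<lambda>_. borel) G ({0, 1} \<times> U)" and U: "finite U" "card U \<le> D" and D: "D \<ge> 1"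
    and G0: "\<And>t. t \<in> U \<Longrightarrow> distributed M lborel (G (0, t)) (normal_density (\<theta>1 t) (sqrt u))"
    and G1: "\<And>t. t \<in> U \<Longrightarrow> distributed M lborel (G (1, t)) (normal_density (\<theta>2 t) (sqrt u))"
    and u: "0 < u" "u \<le> 3 / r" and r: "r > 0"
    and thr: "thr = 4 * sqrt (2 * ln (2 * real D / delta) / r)"
  shows "prob (\<Union>t\<in>U. {\<omega> \<in> space M. \<bar>G (0, t) \<omega> - G (1, t) \<omega> - (\<theta>1 t - \<theta>2 t)\<bar> \<ge> 3 / 4 * thr}) \<le> 1 / 256"
proof -
  define L where "L = ln (2 * real D / delta)"
  have eL: "exp L = 64 * real D" using D by (simp add: L_def delta_def)
  have L: "L \<ge> 0" unfolding L_def using D by (intro ln_ge_zero) (simp add: delta_def)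
  have "8\<^sup>2 \<le> (exp (L / 2))\<^sup>2" unfolding exp_double[symmetric] using eL D by simp
  then have "8 \<le> exp (L / 2)" by (rule power2_le_imp_le) simp
  then have e2: "exp (- (L / 2)) \<le> 1 / 8" unfolding exp_minus by (simp add: field_simps)
  have thr0: "thr \<ge> 0" using L r by (simp add: thr L_def[symmetric])
  have single: "prob {\<omega> \<in> space M. \<bar>G (0, t) \<omega> - G (1, t) \<omega> - (\<theta>1 t - \<theta>2 t)\<bar> \<ge> 3 / 4 * thr} \<le> 1 / (256 * D)"
    if t: "t \<in> U" for t
  proof -
    have "indep_var borel ((\<lambda>g. g (0, t)) \<circ> (\<lambda>\<omega>. restrict (\<lambda>i. G i \<omega>) {(0, t)}))
        borel ((\<lambda>g. g (1, t)) \<circ> (\<lambda>\<omega>. restrict (\<lambda>i. G i \<omega>) {(1, t)}))"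
      by (intro indep_var_compose[OF indep_var_restrict[OF ind]]) (use t in auto)
    then have "indep_var borel (G (0, t)) borel (G (1, t))" by (simp add: comp_def)
    then have "prob {\<omega> \<in> space M. \<bar>G (0, t) \<omega> - G (1, t) \<omega> - (\<theta>1 t - \<theta>2 t)\<bar> \<ge> 3 / 4 * thr}
        \<le> 2 * exp (- (3 / 4 * thr)\<^sup>2 / (4 * u))"
      using thr0 by (intro normal_difference_deviation_bound u G0 G1 t) auto
    also have "\<dots> \<le> 2 * exp (- (L + L / 2))"
    proof -
      have "thr\<^sup>2 = 32 * L / r" using L r by (simp add: thr L_def[symmetric] power_mult_distrib)
      then have "(3 / 4 * thr)\<^sup>2 = 18 * L / r" by (simp add: power_mult_distrib power_divide)
      moreover have "3 / 2 * L * (4 * u) \<le> 3 / 2 * L * (4 * (3 / r))"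
        using u L by (intro mult_left_mono) auto
      ultimately have "3 / 2 * L * (4 * u) \<le> (3 / 4 * thr)\<^sup>2" by simp
      then have "3 / 2 * L \<le> (3 / 4 * thr)\<^sup>2 / (4 * u)" using u by (simp add: pos_le_divide_eq)
      then show ?thesis by simp
    qed
    also have "\<dots> = 2 * (1 / exp L * exp (- (L / 2)))"
      by (simp only: minus_add_distrib exp_add exp_minus[of L] inverse_eq_divide)
    also have "\<dots> \<le> 2 * (1 / (64 * D) * (1 / 8))"
      unfolding eL using mult_left_mono[OF e2, of "1 / (64 * real D)"] by simp
    finally show ?thesis by simp
  qed
  have [measurable]: "G (k, t) \<in> borel_measurable M" if "k \<in> {0, 1}" "t \<in> U" for k t
    using ind that by (auto simp: indep_vars_def)
  have "prob (\<Union>t\<in>U. {\<omega> \<in> space M. \<bar>G (0, t) \<omega> - G (1, t) \<omega> - (\<theta>1 t - \<theta>2 t)\<bar> \<ge> 3 / 4 * thr})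
      \<le> (\<Sum>t\<in>U. prob {\<omega> \<in> space M. \<bar>G (0, t) \<omega> - G (1, t) \<omega> - (\<theta>1 t - \<theta>2 t)\<bar> \<ge> 3 / 4 * thr})"
    using U by (intro finite_measure_subadditive_finite) auto
  also have "\<dots> \<le> (\<Sum>t\<in>U. 1 / (256 * D))" by (intro sum_mono single)
  also have "\<dots> = card U / (256 * D)" by simp
  also have "\<dots> \<le> D / (256 * D)" using U by (intro divide_right_mono) auto
  finally show ?thesis using D by simp
qed

text \<open>The first index of $G$ labels the means: 0, 1 for the first halves of $X$, $Y$; 2, 3 for their
  second halves; 4 for $Z$. Under $H_0$ the pair $(i, j)$ is $(2, 3)$, under $H_1$ it is $(3, 2)$.
  The error event enters only as a subset, which spares its measurability.\<close>

lemma (in prob_space) screened_contrast_error: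
  fixes G :: "nat \<times> nat \<Rightarrow> 'a \<Rightarrow> real" and a :: "nat \<Rightarrow> real" and p \<epsilon> :: real and n m q :: nat
  assumes p: "1 \<le> p" "p \<le> 2"
    and a_mono: "\<And>t. t \<ge> 1 \<Longrightarrow> a (Suc t) \<le> a t"
    and a_pos: "\<And>t. t \<ge> 1 \<Longrightarrow> a t > 0"
    and a_lim: "a \<longlonglongrightarrow> 0"
    and eps: "\<epsilon> > 0"
    and n2: "n \<ge> 2"
    and hm: "real m \<ge> 32 / \<epsilon>\<^sup>2"
    and hn: "real n \<ge> 32 * sqrt (real (d_u a p n \<epsilon>)) / \<epsilon>\<^sup>2"
    and hmn: "real m * real n \<ge> 512 * real (d_u a p n \<epsilon>) / \<epsilon> ^ 4"
    and g: "\<theta>1 \<in> Gamma_set a p" "\<theta>2 \<in> Gamma_set a p" and sep: "\<epsilon> \<le> l2dist \<theta>1 \<theta>2"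
    and D: "D = Dc a \<epsilon>" and du: "du = d_u a p n \<epsilon>" and q: "q = max D du"
    and thr: "thr = 4 * sqrt (2 * ln (2 * real D / delta) / real n)"
    and ind: "indep_vars (\<lambda>_. borel) G ({0, 1, 2, 3, 4} \<times> {1..q})"
    and G0: "\<And>t. t \<in> {1..q} \<Longrightarrow> distributed M lborel (G (0, t)) (normal_density (\<theta>1 t) (sqrt (1 / real (n div 2))))"
    and G1: "\<And>t. t \<in> {1..q} \<Longrightarrow> distributed M lborel (G (1, t)) (normal_density (\<theta>2 t) (sqrt (1 / real (n div 2))))"
    and ij: "i \<in> {2, 3}" "j \<in> {2, 3}" "i \<noteq> j"
    and Gi: "\<And>t. t \<in> {1..q} \<Longrightarrow> distributed M lborel (G (i, t)) (normal_density (\<alpha> t) (sqrt (1 / real (n - n div 2))))"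
    and Gj: "\<And>t. t \<in> {1..q} \<Longrightarrow> distributed M lborel (G (j, t)) (normal_density (\<beta> t) (sqrt (1 / real (n - n div 2))))"
    and G4: "\<And>t. t \<in> {1..q} \<Longrightarrow> distributed M lborel (G (4, t)) (normal_density (\<alpha> t) (sqrt (1 / real m)))"
    and sq: "\<And>t. (\<alpha> t - \<beta> t)\<^sup>2 = (\<theta>1 t - \<theta>2 t)\<^sup>2"
    and A: "A \<subseteq> {\<omega> \<in> space M. (\<Sum>t\<in>{1..du} \<union> {t \<in> {du + 1..D}. \<bar>G (0, t) \<omega> - G (1, t) \<omega>\<bar> \<ge> thr}.
      (G (i, t) \<omega> - G (4, t) \<omega>)\<^sup>2 - (G (j, t) \<omega> - G (4, t) \<omega>)\<^sup>2) \<ge> 0}"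
  shows "prob A \<le> 1 / 4"
proof -
  define U where "U = {du + 1..D}"
  \<comment> \<open>\<open>sel\<close> and \<open>stat\<close> act on plain vectors of means, so the
    events below are preimages under restrictions to disjoint groups of means.\<close>
  define sel where "sel g = {t \<in> U. \<bar>g (0, t) - g (1, t)\<bar> \<ge> thr}" for g :: "nat \<times> nat \<Rightarrow> real"
  define stat where "stat B g = (\<Sum>t\<in>{1..du} \<union> B. (g (i, t) - g (4, t))\<^sup>2 - (g (j, t) - g (4, t))\<^sup>2)"
    for B and g :: "nat \<times> nat \<Rightarrow> real"
  define E where "E B = {\<omega> \<in> space M. sel (\<lambda>k. G k \<omega>) = B}" for B
  define F where "F B = {\<omega> \<in> space M. stat B (\<lambda>k. G k \<omega>) \<ge> 0}" for B
  define Fail where "Fail = (\<Union>t\<in>U. {\<omega> \<in> space M. \<bar>G (0, t) \<omega> - G (1, t) \<omega> - (\<theta>1 t - \<theta>2 t)\<bar> \<ge> 3 / 4 * thr})"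
  \<comment> \<open>The values that screening can take outside \<open>Fail\<close>: with deviations
    below 3/4 \<open>thr\<close>, passing the level \<open>thr\<close> forces a difference of at
    least \<open>thr\<close>/4, and missing it allows at most 7/4 \<open>thr\<close>.\<close>
  define \<B> where "\<B> = {B \<in> Pow U. (\<forall>t\<in>B. \<bar>\<theta>1 t - \<theta>2 t\<bar> \<ge> thr / 4) \<and> (\<forall>t\<in>U - B. \<bar>\<theta>1 t - \<theta>2 t\<bar> \<le> 7 / 4 * thr)}"
  have D1: "D \<ge> 1" using Dc_spec(1)[OF a_lim eps] D by simp
  have Uq: "U \<subseteq> {1..q}" by (auto simp: U_def q)
  have duq: "{1..du} \<subseteq> {1..q}" by (auto simp: q)
  have "0 < 32 / \<epsilon>\<^sup>2" using eps by simp
  then have m0: "real m > 0" using hm by linarith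
  have [measurable]: "G (k, t) \<in> borel_measurable M" if "k \<in> {0, 1, 2, 3, 4}" "t \<in> {1..q}" for k t
    using ind that by (auto simp: indep_vars_def)
  \<comment> \<open>Equality in the first bound occurs at n = 3; in the second, for even n.\<close>
  have "n \<le> 3 * (n div 2)" "n \<le> 2 * (n - n div 2)" using n2 by presburger+
  then have "real n \<le> 3 * real (n div 2)" "real n \<le> 2 * real (n - n div 2)" by linarith+
  moreover have "real (n div 2) > 0" "real (n - n div 2) > 0" "real n > 0" using n2 by auto
  ultimately have halves: "1 / real (n div 2) > 0" "1 / real (n div 2) \<le> 3 / real n"
    "1 / real (n - n div 2) > 0" "1 / real (n - n div 2) \<le> 2 / real n" "real n > 0"
    by (auto simp: field_simps)
  have fail: "prob Fail \<le> 1 / 256"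
    unfolding Fail_def
  proof (rule screening_failure_bound[OF _ _ _ D1 _ _ halves(1,2,5) thr])
    show "indep_vars (\<lambda>_. borel) G ({0, 1} \<times> U)"
      by (rule indep_vars_subset[OF ind]) (use Uq in auto)
  qed (use Uq G0 G1 in \<open>auto simp: U_def\<close>)
  have Fail_meas: "Fail \<in> events"
    unfolding Fail_def
  proof (rule sets.finite_UN)
    fix t assume "t \<in> U"
    then have [measurable]: "G (0, t) \<in> borel_measurable M" "G (1, t) \<in> borel_measurable M"
      using Uq by auto
    show "{\<omega> \<in> space M. \<bar>G (0, t) \<omega> - G (1, t) \<omega> - (\<theta>1 t - \<theta>2 t)\<bar> \<ge> 3 / 4 * thr} \<in> events"
      by measurable
  qed (simp add: U_def)
  \<comment> \<open>\<open>E B\<close> reads the means labelled 0 and 1, \<open>F B\<close> those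
    labelled 2, 3, 4; hence the product formula.\<close>
  have pair: "E B \<in> events" "F B \<in> events" "prob (E B \<inter> F B) = prob (E B) * prob (F B)"
    "prob (F B) \<le> exp (- (141 / 100))" if B: "B \<in> \<B>" for B
  proof -
    have BU: "B \<subseteq> U" using B by (auto simp: \<B>_def)
    let ?P = "{0, 1} \<times> {1..q} :: (nat \<times> nat) set"
    let ?R = "{2, 3, 4} \<times> {1..q} :: (nat \<times> nat) set"
    let ?XE = "{g \<in> space (PiM ?P (\<lambda>_. borel)). sel g = B}"
    let ?XF = "{g \<in> space (PiM ?R (\<lambda>_. borel)). stat B g \<ge> 0}"
    have XE: "?XE \<in> sets (PiM ?P (\<lambda>_. borel))"
    proof -
      have [measurable]: "(\<lambda>g. g (k, t)) \<in> borel_measurable (PiM ?P (\<lambda>_. borel))" if "k \<in> {0, 1}" "t \<in> U" for k t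
        using that Uq by (intro measurable_component_singleton) auto
      have "sel g = B \<longleftrightarrow> (\<forall>t\<in>U. \<bar>g (0, t) - g (1, t)\<bar> \<ge> thr \<longleftrightarrow> t \<in> B)" for g
        using BU by (auto simp: sel_def)
      then show ?thesis unfolding U_def[symmetric] by (simp only:) measurable
    qed
    have XF: "?XF \<in> sets (PiM ?R (\<lambda>_. borel))"
    proof -
      have comp: "(\<lambda>g. g (k, t)) \<in> borel_measurable (PiM ?R (\<lambda>_. borel))"
        if "k \<in> {i, j, 4}" "t \<in> {1..du} \<union> B" for k t
        using that Uq duq BU ij by (intro measurable_component_singleton) auto
      have "(\<lambda>g. stat B g) \<in> borel_measurable (PiM ?R (\<lambda>_. borel))"
        unfolding stat_def
        by (intro borel_measurable_sum borel_measurable_diff borel_measurable_power comp) auto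
      then show ?thesis by measurable
    qed
    have ER: "E B = (\<lambda>\<omega>. restrict (\<lambda>k. G k \<omega>) ?P) -` ?XE \<inter> space M"
    proof -
      have "sel (restrict (\<lambda>k. G k \<omega>) ?P) = sel (\<lambda>k. G k \<omega>)" for \<omega>
        using Uq by (auto simp: sel_def)
      then show ?thesis by (auto simp: E_def space_PiM)
    qed
    have FR: "F B = (\<lambda>\<omega>. restrict (\<lambda>k. G k \<omega>) ?R) -` ?XF \<inter> space M"
    proof -
      have "stat B (restrict (\<lambda>k. G k \<omega>) ?R) = stat B (\<lambda>k. G k \<omega>)" for \<omega>
        unfolding stat_def using Uq duq BU ij by (intro sum.cong refl) auto
      then show ?thesis by (auto simp: F_def space_PiM)
    qed
    have PR: "indep_var (PiM ?P (\<lambda>_. borel)) (\<lambda>\<omega>. restrict (\<lambda>k. G k \<omega>) ?P)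
        (PiM ?R (\<lambda>_. borel)) (\<lambda>\<omega>. restrict (\<lambda>k. G k \<omega>) ?R)"
      by (rule indep_var_restrict[OF ind]) auto
    show "E B \<in> events" unfolding ER
      by (rule measurable_sets[OF indep_var_rv1[OF PR] XE])
    show "F B \<in> events" unfolding FR
      by (rule measurable_sets[OF indep_var_rv2[OF PR] XF])
    have "E B \<inter> F B = (\<lambda>\<omega>. (restrict (\<lambda>k. G k \<omega>) ?P, restrict (\<lambda>k. G k \<omega>) ?R)) -` (?XE \<times> ?XF) \<inter> space M"
      unfolding ER FR by blast
    then show "prob (E B \<inter> F B) = prob (E B) * prob (F B)"
      using indep_varD[OF PR XE XF] unfolding ER FR by simp
    define T where "T = {1..du} \<union> B"
    have Tq: "T \<subseteq> {1..q}" using duq BU Uq by (auto simp: T_def)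
    obtain l x where l: "l > 0"
      and small: "2 * l * (1 / real (n - n div 2)) + 4 * l\<^sup>2 * (1 / real m) * (1 / real (n - n div 2)) < 1"
      and x: "x = 4 * l\<^sup>2 * (1 / real (n - n div 2)) * (1 / real (n - n div 2) + 2 * (1 / real m))" "x < 1"
      and le: "(real (card T) * x / 2 - (\<Sum>t\<in>T. (\<theta>1 t - \<theta>2 t)\<^sup>2) *
          (l - 2 * l\<^sup>2 * (1 / real (n - n div 2) + 1 / real m))) / (1 - x) \<le> - (141 / 100)"
      using selected_set_exponent[OF p a_mono a_pos a_lim eps n2 hm hn hmn g sep _ thr[unfolded D] _ _ _ halves(3,4) refl,
          of B T] B by (auto simp: \<B>_def U_def D du T_def)
    have "prob (F B) \<le> exp ((real (card T) * x / 2 - (\<Sum>t\<in>T. (\<alpha> t - \<beta> t)\<^sup>2) *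
          (l - 2 * l\<^sup>2 * (1 / real (n - n div 2) + 1 / real m))) / (1 - x))"
      unfolding F_def stat_def T_def[symmetric]
    proof (rule contrast_sum_tail_bound[OF _ _ ij(3) _ _ _ _ _ halves(3) _ l small x])
      show "indep_vars (\<lambda>_. borel) G ({i, j, 4} \<times> T)"
        by (rule indep_vars_subset[OF ind]) (use Tq ij in auto)
      show "finite T" using Tq by (rule finite_subset) simp
    qed (use ij Tq Gi Gj G4 m0 in auto)
    also have "\<dots> \<le> exp (- (141 / 100))" using le by (simp add: sq)
    finally show "prob (F B) \<le> exp (- (141 / 100))" .
  qed
  have fin: "finite \<B>" by (rule finite_subset[of _ "Pow U"]) (auto simp: \<B>_def U_def)
  have union: "prob (\<Union>B\<in>\<B>. E B \<inter> F B) \<le> exp (- (141 / 100))"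
    by (rule prob_Union_indep_pairs_le[OF fin pair(1,2) _ pair(3,4)])
      (auto simp: disjoint_family_on_def E_def)
  have union_meas: "(\<Union>B\<in>\<B>. E B \<inter> F B) \<in> events"
    using fin pair by (intro sets.finite_UN) auto
  have sub: "{\<omega> \<in> space M. (\<Sum>t\<in>{1..du} \<union> {t \<in> {du + 1..D}. \<bar>G (0, t) \<omega> - G (1, t) \<omega>\<bar> \<ge> thr}.
      (G (i, t) \<omega> - G (4, t) \<omega>)\<^sup>2 - (G (j, t) \<omega> - G (4, t) \<omega>)\<^sup>2) \<ge> 0} \<subseteq> Fail \<union> (\<Union>B\<in>\<B>. E B \<inter> F B)"
  proof
    fix \<omega> assume w: "\<omega> \<in> {\<omega> \<in> space M. (\<Sum>t\<in>{1..du} \<union> {t \<in> {du + 1..D}. \<bar>G (0, t) \<omega> - G (1, t) \<omega>\<bar> \<ge> thr}.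
      (G (i, t) \<omega> - G (4, t) \<omega>)\<^sup>2 - (G (j, t) \<omega> - G (4, t) \<omega>)\<^sup>2) \<ge> 0}"
    let ?B = "sel (\<lambda>k. G k \<omega>)"
    have EF: "\<omega> \<in> E ?B \<inter> F ?B" using w by (auto simp: E_def F_def stat_def sel_def U_def)
    show "\<omega> \<in> Fail \<union> (\<Union>B\<in>\<B>. E B \<inter> F B)"
    proof (cases "\<omega> \<in> Fail")
      case False
      then have dev: "\<bar>G (0, t) \<omega> - G (1, t) \<omega> - (\<theta>1 t - \<theta>2 t)\<bar> < 3 / 4 * thr" if "t \<in> U" for t
        using w that by (force simp: Fail_def)
      have "?B \<in> \<B>"
        unfolding \<B>_def sel_def using dev by (fastforce simp: abs_if split: if_splits)
      then show ?thesis using EF by blast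
    qed simp
  qed
  show ?thesis
    using finite_measure_mono[OF order_trans[OF A sub]] measure_Un_le[OF Fail_meas union_meas] Fail_meas union_meas
      fail union exp_minus_141_le by simp
qed

theorem mainTheorem10:
  fixes a :: "nat \<Rightarrow> real" and p \<epsilon> :: real and n m :: nat
  assumes p: "1 \<le> p" "p \<le> 2"
    and a_mono: "\<And>t. t \<ge> 1 \<Longrightarrow> a (Suc t) \<le> a t"
    and a_pos: "\<And>t. t \<ge> 1 \<Longrightarrow> a t > 0"
    and a_lim: "a \<longlonglongrightarrow> 0"
    and eps: "\<epsilon> > 0"
    and n2: "n \<ge> 2"
    and hm: "real m \<ge> 32 / \<epsilon>\<^sup>2"
    and hn: "real n \<ge> 32 * sqrt (real (d_u a p n \<epsilon>)) / \<epsilon>\<^sup>2"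
    and hmn: "real m * real n \<ge> 512 * real (d_u a p n \<epsilon>) / \<epsilon> ^ 4"
  shows "\<forall>\<theta>1 \<in> Gamma_set a p. \<forall>\<theta>2 \<in> Gamma_set a p. l2dist \<theta>1 \<theta>2 \<ge> \<epsilon> \<longrightarrow>
     (let M0 = lfht_measure n m \<theta>1 \<theta>2 \<theta>1; M1 = lfht_measure n m \<theta>1 \<theta>2 \<theta>2 in
       measure M0 {\<omega> \<in> space M0. lfht_test a p \<epsilon> n m (fst (fst \<omega>)) (snd (fst \<omega>)) (snd \<omega>)} \<le> 1/4
     \<and> measure M1 {\<omega> \<in> space M1. \<not> lfht_test a p \<epsilon> n m (fst (fst \<omega>)) (snd (fst \<omega>)) (snd \<omega>)} \<le> 1/4)"
proof (intro ballI impI)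
  fix \<theta>1 \<theta>2
  assume g: "\<theta>1 \<in> Gamma_set a p" "\<theta>2 \<in> Gamma_set a p" and sep: "\<epsilon> \<le> l2dist \<theta>1 \<theta>2"
  define D where "D = Dc a \<epsilon>"
  define du where "du = d_u a p n \<epsilon>"
  define q where "q = max D du"
  define thr where "thr = 4 * sqrt (2 * ln (2 * real D / delta) / real n)"
  have q1: "q \<ge> 1" using Dc_spec(1)[OF a_lim eps] by (simp add: q_def D_def)
  have m1: "m \<ge> 1"
  proof -
    have "0 < 32 / \<epsilon>\<^sup>2" using eps by simp
    then have "0 < real m" using hm by linarith
    then show ?thesis by simp
  qed
  \<comment> \<open>Parity separates X (0 and 2) from Y (1 and 3); label 4 is Z.\<close>
  define kind :: "nat \<Rightarrow> nat" where "kind j = (if j = 4 then 2 else j mod 2)" for j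
  define I where "I j = (if j = 4 then {1..m} else if j < 2 then {1..n div 2} else {n div 2 + 1..n})" for j :: nat
  define G where "G = (\<lambda>(j, t) \<omega>. (\<Sum>i\<in>I j. lfht_coord (kind j, i, t) \<omega>) / real (card (I j)))"
  have G: "G (0, t) \<omega> = smean (fst (fst \<omega>)) {1..n div 2} t"
    "G (1, t) \<omega> = smean (snd (fst \<omega>)) {1..n div 2} t"
    "G (2, t) \<omega> = smean (fst (fst \<omega>)) {n div 2 + 1..n} t"
    "G (3, t) \<omega> = smean (snd (fst \<omega>)) {n div 2 + 1..n} t"
    "G (4, t) \<omega> = smean (snd \<omega>) {1..m} t" for t \<omega>
    by (auto simp: G_def I_def kind_def smean_def lfht_coord_def)
  have test: "lfht_test a p \<epsilon> n m (fst (fst \<omega>)) (snd (fst \<omega>)) (snd \<omega>) \<longleftrightarrow>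
      (\<Sum>t\<in>{1..du} \<union> {t \<in> {du + 1..D}. \<bar>G (0, t) \<omega> - G (1, t) \<omega>\<bar> \<ge> thr}.
        (G (2, t) \<omega> - G (4, t) \<omega>)\<^sup>2 - (G (3, t) \<omega> - G (4, t) \<omega>)\<^sup>2) \<ge> 0" for \<omega>
    unfolding lfht_test_def Let_def G D_def du_def thr_def ..
  have model: "prob_space.indep_vars (lfht_measure n m \<theta>1 \<theta>2 \<theta>) (\<lambda>_. borel) G ({0, 1, 2, 3, 4} \<times> {1..q})"
    "\<And>j t. j \<in> {0, 1, 2, 3, 4} \<Longrightarrow> t \<in> {1..q} \<Longrightarrow> distributed (lfht_measure n m \<theta>1 \<theta>2 \<theta>) lborel (G (j, t))
      (normal_density ((if kind j = 0 then \<theta>1 else if kind j = 1 then \<theta>2 else \<theta>) t) (sqrt (1 / real (card (I j)))))" for \<theta>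
  proof -
    interpret prob_space "lfht_measure n m \<theta>1 \<theta>2 \<theta>" by (rule prob_space_lfht_measure)
    have n1: "n \<ge> 1" using n2 by simp
    note coord = lfht_coord_indep_normal[OF n1 q1, where m = m and ?\<theta>1.0 = \<theta>1 and ?\<theta>2.0 = \<theta>2 and \<theta> = \<theta>]
    let ?F = "Sigma {0, 1, 2} (\<lambda>k::nat. {1..if k = 2 then m else n} \<times> {1..q})"
    have F: "{kind j} \<times> I j \<times> {t} \<subseteq> ?F" if "j \<in> {0, 1, 2, 3, 4}" "t \<in> {1..q}" for j t
      using that n2 by (auto simp: kind_def I_def)
    \<comment> \<open>Both halves are nonempty by n \<ge> 2; an empty block would have mean 0 by the
      convention for division by 0, not a normal law.\<close>
    have I: "finite (I j)" "I j \<noteq> {}" for j using n2 m1 by (auto simp: I_def)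
    have disj: "I i \<inter> I j = {}" if "i \<in> {0, 1, 2, 3, 4}" "j \<in> {0, 1, 2, 3, 4}" "i \<noteq> j" "kind i = kind j" for i j
      using that by (auto simp: I_def kind_def)
    show "indep_vars (\<lambda>_. borel) G ({0, 1, 2, 3, 4} \<times> {1..q})"
      unfolding G_def by (rule block_means(1)[OF coord(1) F I disj coord(2)])
    show "distributed (lfht_measure n m \<theta>1 \<theta>2 \<theta>) lborel (G (j, t))
      (normal_density ((if kind j = 0 then \<theta>1 else if kind j = 1 then \<theta>2 else \<theta>) t) (sqrt (1 / real (card (I j)))))"
      if "j \<in> {0, 1, 2, 3, 4}" "t \<in> {1..q}" for j t
      unfolding G_def by (rule block_means(2)[OF coord(1) F I disj coord(2) that])
  qed
  have dist: "distributed (lfht_measure n m \<theta>1 \<theta>2 \<theta>) lborel (G (0, t)) (normal_density (\<theta>1 t) (sqrt (1 / real (n div 2))))"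
    "distributed (lfht_measure n m \<theta>1 \<theta>2 \<theta>) lborel (G (1, t)) (normal_density (\<theta>2 t) (sqrt (1 / real (n div 2))))"
    "distributed (lfht_measure n m \<theta>1 \<theta>2 \<theta>) lborel (G (2, t)) (normal_density (\<theta>1 t) (sqrt (1 / real (n - n div 2))))"
    "distributed (lfht_measure n m \<theta>1 \<theta>2 \<theta>) lborel (G (3, t)) (normal_density (\<theta>2 t) (sqrt (1 / real (n - n div 2))))"
    "distributed (lfht_measure n m \<theta>1 \<theta>2 \<theta>) lborel (G (4, t)) (normal_density (\<theta> t) (sqrt (1 / real m)))"
    if "t \<in> {1..q}" for t \<theta>
    using model(2)[OF _ that, of 0 \<theta>] model(2)[OF _ that, of 1 \<theta>] model(2)[OF _ that, of 2 \<theta>]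
      model(2)[OF _ that, of 3 \<theta>] model(2)[OF _ that, of 4 \<theta>]
    by (simp_all add: kind_def I_def)
  define M0 where "M0 = lfht_measure n m \<theta>1 \<theta>2 \<theta>1"
  define M1 where "M1 = lfht_measure n m \<theta>1 \<theta>2 \<theta>2"
  interpret M0: prob_space M0 unfolding M0_def by (rule prob_space_lfht_measure)
  interpret M1: prob_space M1 unfolding M1_def by (rule prob_space_lfht_measure)
  note err0 = M0.screened_contrast_error[OF p a_mono a_pos a_lim eps n2 hm hn hmn g sep D_def du_def q_def thr_def
      model(1)[of \<theta>1, folded M0_def] dist(1)[of _ \<theta>1, folded M0_def] dist(2)[of _ \<theta>1, folded M0_def]]
  note err1 = M1.screened_contrast_error[OF p a_mono a_pos a_lim eps n2 hm hn hmn g sep D_def du_def q_def thr_def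
      model(1)[of \<theta>2, folded M1_def] dist(1)[of _ \<theta>2, folded M1_def] dist(2)[of _ \<theta>2, folded M1_def]]
  have "measure M0 {\<omega> \<in> space M0. lfht_test a p \<epsilon> n m (fst (fst \<omega>)) (snd (fst \<omega>)) (snd \<omega>)} \<le> 1 / 4"
    by (rule err0[where \<alpha> = \<theta>1 and \<beta> = \<theta>2 and i = 2 and j = 3])
      (use dist[of _ \<theta>1] in \<open>auto simp: M0_def test\<close>)
  \<comment> \<open>Accepting means a negative statistic. With labels 2 and 3 exchanged it becomes
    positive, so the error event is contained in the one already bounded; ties only enlarge the
    latter.\<close>
  moreover have "measure M1 {\<omega> \<in> space M1. \<not> lfht_test a p \<epsilon> n m (fst (fst \<omega>)) (snd (fst \<omega>)) (snd \<omega>)} \<le> 1 / 4"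
    by (rule err1[where \<alpha> = \<theta>2 and \<beta> = \<theta>1 and i = 3 and j = 2])
      (use dist[of _ \<theta>2] in \<open>auto simp: M1_def test power2_commute sum_subtractf\<close>)
  ultimately show "let M0 = lfht_measure n m \<theta>1 \<theta>2 \<theta>1; M1 = lfht_measure n m \<theta>1 \<theta>2 \<theta>2 in
       measure M0 {\<omega> \<in> space M0. lfht_test a p \<epsilon> n m (fst (fst \<omega>)) (snd (fst \<omega>)) (snd \<omega>)} \<le> 1/4
     \<and> measure M1 {\<omega> \<in> space M1. \<not> lfht_test a p \<epsilon> n m (fst (fst \<omega>)) (snd (fst \<omega>)) (snd \<omega>)} \<le> 1/4"
    unfolding M0_def M1_def Let_def by blast
qed

end
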